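(* Let $K$ be a compact metric space and let $\xi_1,\xi_2$ be countable ordinals. If $f\in\mathfrak{B}_1^{\xi_1}(K)$ and $g\in\mathfrak{B}_1^{\xi_2}(K)$, then $fg\in\mathfrak{B}_1^{\xi}(K)$, where $\xi=\max\{\xi_1+\xi_2,\ \xi_2+\xi_1\}$.
   Context: A function on a compact metric space is Baire-1 if it is the pointwise limit of a sequence of real-valued continuous functions. $\mathfrak{B}_1(K)$ is the set of all (not necessarily bounded) real-valued Baire-1 functions on $K$. Oscillation index. Let $H$ be a compact metric space, $f$ a real-valued function whose domain contains $H$, and $\varepsilon>0$. Put $H^0(f,\varepsilon)=H$. For a countable ordinal $\alpha$, $H^{\alpha+1}(f,\varepsilon)$ is the set of all $x\in H^\alpha(f,\varepsilon)$ such that for every open set $U$ containing $x$ there are $x_1,x_2\in U\cap H^\alpha(f,\varepsilon)$ with $|f(x_1)-f(x_2)|\ge\varepsilon$. For a countable limit ordinal $\alpha$, $H^\alpha(f,\varepsilon)=\bigcap_{\alpha'<\alpha}H^{\alpha'}(f,\varepsilon)$. Let $\beta_H(f,\varepsilon)$ be the least countable $\alpha$ with $H^\alpha(f,\varepsilon)=\emptyset$ if such $\alpha$ exists, and $\omega_1$ otherwise; $\beta_H(f)=\sup_{\varepsilon>0}\beta_H(f,\varepsilon)$. Write $\beta$ for $\beta_K$. For a countable ordinal $\xi$: $\mathfrak{B}_1^\xi(K)=\{f\in\mathfrak{B}_1(K):\beta(f)\le\omega^\xi\}$. Ordinal sums and powers are in the sense of ordinal arithmetic. *)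

theory Defs
  imports "HOL-Analysis.Analysis"
begin

unbundle cardinal_syntax

text \<open>The ordinals below \<open>\<omega>\<^sub>2\<close>, realised as the field of the initial well-order of that
  cardinal. They contain all countable ordinals and \<open>\<omega>\<^sub>1\<close>, and they are closed under successors
  and under suprema of sets of at most \<open>\<aleph>\<^sub>1\<close> elements. An ordinal \<open>\<alpha>\<close> is identified with
  its set \<open>{..<\<alpha>}\<close> of predecessors; in particular \<open>\<alpha>\<close> is countable iff \<open>countable {..<\<alpha>}\<close>.\<close>

abbreviation omega2_rel :: "nat set set rel"
  where "omega2_rel \<equiv> cardSuc (cardSuc natLeq)"

lemma Card_order_omega2_rel: "Card_order omega2_rel"
  by (intro cardSuc_Card_order natLeq_Card_order)

lemma infinite_Field_omega1: "infinite (Field (cardSuc natLeq))"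
  unfolding cardSuc_finite[OF natLeq_Card_order] Field_natLeq by (rule infinite_UNIV_nat)

lemma infinite_Field_omega2: "infinite (Field omega2_rel)"
  unfolding cardSuc_finite[OF cardSuc_Card_order[OF natLeq_Card_order]]
  by (rule infinite_Field_omega1)

lemma Well_order_omega2_rel: "Well_order omega2_rel"
  using Card_order_omega2_rel by (rule card_order_on_well_order_on)

typedef ordinal = "Field omega2_rel"
  using infinite_imp_nonempty[OF infinite_Field_omega2] by (simp only: ex_in_conv not_False_eq_True)

instantiation ordinal :: wellorder
begin

definition less_eq_ordinal :: "ordinal \<Rightarrow> ordinal \<Rightarrow> bool"
  where "\<alpha> \<le> \<beta> \<longleftrightarrow> (Rep_ordinal \<alpha>, Rep_ordinal \<beta>) \<in> omega2_rel"

definition less_ordinal :: "ordinal \<Rightarrow> ordinal \<Rightarrow> bool"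
  where "\<alpha> < \<beta> \<longleftrightarrow> \<alpha> \<le> \<beta> \<and> \<alpha> \<noteq> (\<beta>::ordinal)"

instance
proof
  have wo: "Well_order omega2_rel" by (rule Well_order_omega2_rel)
  then have refl: "refl_on (Field omega2_rel) omega2_rel" and tr: "trans omega2_rel"
    and anti: "antisym omega2_rel" and tot: "total_on (Field omega2_rel) omega2_rel"
    and wf: "wf (omega2_rel - Id)"
    by (auto simp: well_order_on_def linear_order_on_def partial_order_on_def preorder_on_def)
  fix x y z :: ordinal
  show "x \<le> x"
    using refl Rep_ordinal by (auto simp: less_eq_ordinal_def refl_on_def)
  show "x \<le> z" if "x \<le> y" "y \<le> z"
    using that tr by (auto simp: less_eq_ordinal_def dest: transD)
  show eq: "x = y" if "x \<le> y" "y \<le> x" for x y :: ordinal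
    using that anti by (auto simp: less_eq_ordinal_def Rep_ordinal_inject dest: antisymD)
  show "(x < y) = (x \<le> y \<and> \<not> y \<le> x)"
    using eq by (auto simp: less_ordinal_def less_eq_ordinal_def \<open>x \<le> x\<close>)
  show "x \<le> y \<or> y \<le> x"
    using tot refl Rep_ordinal[of x] Rep_ordinal[of y]
    by (cases "Rep_ordinal x = Rep_ordinal y") (auto simp: less_eq_ordinal_def total_on_def refl_on_def)
  show "P a" if ind: "\<And>x. (\<And>y. y < x \<Longrightarrow> P y) \<Longrightarrow> P x" for P and a :: ordinal
  proof -
    have "wf (inv_image (omega2_rel - Id) Rep_ordinal)" using wf by (rule wf_inv_image)
    then show ?thesis
    proof (induction a rule: wf_induct_rule)
      case (less x)
      show ?case
        by (rule ind, rule less) (auto simp: less_ordinal_def less_eq_ordinal_def Rep_ordinal_inject)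
    qed
  qed
qed

end

instance ordinal :: no_top
proof
  fix a :: ordinal
  obtain b where "b \<in> Field omega2_rel" "Rep_ordinal a \<noteq> b" "(Rep_ordinal a, b) \<in> omega2_rel"
    using infinite_Card_order_limit[OF Card_order_omega2_rel infinite_Field_omega2 Rep_ordinal] by blast
  then have "a < Abs_ordinal b"
    by (auto simp: less_ordinal_def less_eq_ordinal_def Abs_ordinal_inverse)
  then show "\<exists>b. a < b" ..
qed

lemma card_lessThan_ordinal: "|{..<\<alpha>::ordinal}| <o omega2_rel"
proof -
  have *: "Rep_ordinal ` {..<\<alpha>} \<subseteq> underS omega2_rel (Rep_ordinal \<alpha>)"
    by (auto simp: underS_def less_ordinal_def less_eq_ordinal_def Rep_ordinal_inject)
  have "|{..<\<alpha>}| =o |Rep_ordinal ` {..<\<alpha>}|"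
    by (rule card_of_ordIsoI[of Rep_ordinal]) (auto simp: bij_betw_def inj_on_def Rep_ordinal_inject)
  also have "|Rep_ordinal ` {..<\<alpha>}| \<le>o |underS omega2_rel (Rep_ordinal \<alpha>)|"
    using * by (rule card_of_mono1)
  also have "|underS omega2_rel (Rep_ordinal \<alpha>)| <o omega2_rel"
    by (rule card_of_underS[OF Card_order_omega2_rel Rep_ordinal])
  finally show ?thesis .
qed

lemma ex_greater_ordinal:
  assumes "|A| <o omega2_rel"
  shows "\<exists>\<beta>::ordinal. \<forall>\<alpha>\<in>A. \<alpha> < \<beta>"
proof (rule ccontr)
  assume no: "\<not> (\<exists>\<beta>. \<forall>\<alpha>\<in>A. \<alpha> < \<beta>)"
  have reg: "regularCard omega2_rel"
    by (intro infinite_cardSuc_regularCard infinite_Field_omega1 cardSuc_Card_order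
        natLeq_Card_order)
  have "cofinal (Rep_ordinal ` A) omega2_rel"
    unfolding cofinal_def
  proof
    fix a assume a: "a \<in> Field omega2_rel"
    obtain b where b: "Abs_ordinal a < b" using gt_ex by blast
    obtain c where "c \<in> A" "\<not> c < b" using no by blast
    with b have "Abs_ordinal a < c" by auto
    then have "a \<noteq> Rep_ordinal c \<and> (a, Rep_ordinal c) \<in> omega2_rel"
      using a by (auto simp: less_ordinal_def less_eq_ordinal_def Abs_ordinal_inverse Rep_ordinal_inverse)
    with \<open>c \<in> A\<close> show "\<exists>b\<in>Rep_ordinal ` A. a \<noteq> b \<and> (a, b) \<in> omega2_rel" by blast
  qed
  moreover have "Rep_ordinal ` A \<subseteq> Field omega2_rel" using Rep_ordinal by auto
  ultimately have "|Rep_ordinal ` A| =o omega2_rel" using reg by (auto simp: regularCard_def)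
  then have "omega2_rel =o |Rep_ordinal ` A|" by (rule ordIso_symmetric)
  also have "|Rep_ordinal ` A| \<le>o |A|" by (rule card_of_image)
  also note assms
  finally show False using ordLess_irreflexive by (rule notE[rotated])
qed

lemma bdd_above_image_lessThan_ordinal: "bdd_above (F ` {..<\<alpha>})"
  for F :: "ordinal \<Rightarrow> ordinal"
proof -
  have "|F ` {..<\<alpha>}| <o omega2_rel"
    by (rule ordLeq_ordLess_trans[OF card_of_image card_lessThan_ordinal])
  from ex_greater_ordinal[OF this] show ?thesis by (auto simp: bdd_above_def intro: less_imp_le)
qed

text \<open>\<open>Sup\<close> is the least upper bound whenever the set is bounded above.\<close>

instantiation ordinal :: conditionally_complete_linorder
begin

definition inf_ordinal :: "ordinal \<Rightarrow> ordinal \<Rightarrow> ordinal" where "inf_ordinal = min"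
definition sup_ordinal :: "ordinal \<Rightarrow> ordinal \<Rightarrow> ordinal" where "sup_ordinal = max"
definition Inf_ordinal where "Inf (A::ordinal set) = (LEAST \<alpha>. \<alpha> \<in> A)"
definition Sup_ordinal where "Sup (A::ordinal set) = (LEAST \<beta>. \<forall>\<alpha>\<in>A. \<alpha> \<le> \<beta>)"

instance
proof
  fix x z :: ordinal and X :: "ordinal set"
  show "Inf X \<le> x" if "x \<in> X" using that by (auto simp: Inf_ordinal_def intro: Least_le)
  show "z \<le> Inf X" if ne: "X \<noteq> {}" and lb: "\<And>x. x \<in> X \<Longrightarrow> z \<le> x"
  proof -
    obtain w where "w \<in> X" using ne by blast
    then have "Inf X \<in> X" unfolding Inf_ordinal_def by (rule LeastI)
    then show ?thesis by (rule lb)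
  qed
  show "x \<le> Sup X" if x: "x \<in> X" and bdd: "bdd_above X"
  proof -
    obtain b where "\<forall>\<alpha>\<in>X. \<alpha> \<le> b" using bdd by (auto simp: bdd_above_def)
    then have "\<forall>\<alpha>\<in>X. \<alpha> \<le> Sup X" unfolding Sup_ordinal_def by (rule LeastI)
    with x show ?thesis by blast
  qed
  show "Sup X \<le> z" if "X \<noteq> {}" "\<And>x. x \<in> X \<Longrightarrow> x \<le> z"
    using that by (auto simp: Sup_ordinal_def intro: Least_le)
qed (auto simp: inf_ordinal_def sup_ordinal_def)

end

definition osuc :: "ordinal \<Rightarrow> ordinal"
  where "osuc \<alpha> = (LEAST \<beta>. \<alpha> < \<beta>)"

instantiation ordinal :: "{zero, one}"
begin

definition zero_ordinal :: ordinal where "0 = (LEAST \<alpha>::ordinal. True)"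
definition one_ordinal :: ordinal where "1 = osuc 0"

instance ..

end

definition limit_ordinal :: "ordinal \<Rightarrow> bool"
  where "limit_ordinal \<alpha> \<longleftrightarrow> \<alpha> \<noteq> 0 \<and> (\<nexists>\<gamma>. \<alpha> = osuc \<gamma>)"

lemma zero_le_ordinal [simp]: "0 \<le> (\<alpha>::ordinal)"
  unfolding zero_ordinal_def by (rule Least_le) simp

lemma less_osuc [simp]: "\<alpha> < osuc \<alpha>"
  unfolding osuc_def using gt_ex by (rule LeastI_ex)

lemma less_osuc_iff: "\<beta> < osuc \<alpha> \<longleftrightarrow> \<beta> \<le> \<alpha>"
proof
  show "\<beta> \<le> \<alpha>" if "\<beta> < osuc \<alpha>"
    using that not_less_Least[of \<beta> "\<lambda>\<beta>. \<alpha> < \<beta>"] by (auto simp: osuc_def)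
  show "\<beta> < osuc \<alpha>" if "\<beta> \<le> \<alpha>"
    using that less_osuc by (rule le_less_trans)
qed

lemma osuc_inject [simp]: "osuc \<alpha> = osuc \<beta> \<longleftrightarrow> \<alpha> = \<beta>"
  by (metis less_osuc_iff order_antisym order_refl)

lemma osuc_neq_zero [simp]: "osuc \<alpha> \<noteq> 0"
  by (metis less_osuc not_le zero_le_ordinal)

text \<open>Transfinite recursion: value \<open>z\<close> at 0, step \<open>s\<close> at successors, and at a limit the
  operation \<open>l\<close> applied to the set of all earlier values.\<close>

function orec :: "'b \<Rightarrow> ('b \<Rightarrow> 'b) \<Rightarrow> ('b set \<Rightarrow> 'b) \<Rightarrow> ordinal \<Rightarrow> 'b" where
  "orec z s l \<alpha> =
     (if \<alpha> = 0 then z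
      else if \<exists>\<gamma>. \<alpha> = osuc \<gamma> then s (orec z s l (THE \<gamma>. \<alpha> = osuc \<gamma>))
      else l (orec z s l ` {..<\<alpha>}))"
  by auto
termination
  by (relation "inv_image {(x, y). x < y} (\<lambda>(z, s, l, \<alpha>). \<alpha>)") (auto intro: wf)

declare orec.simps [simp del]

lemma orec_0: "orec z s l 0 = z"
  by (simp add: orec.simps)

lemma orec_osuc: "orec z s l (osuc \<alpha>) = s (orec z s l \<alpha>)"
  by (simp add: orec.simps[of z s l "osuc \<alpha>"])

lemma orec_limit: "limit_ordinal \<alpha> \<Longrightarrow> orec z s l \<alpha> = l (orec z s l ` {..<\<alpha>})"
  by (auto simp: orec.simps[of z s l \<alpha>] limit_ordinal_def)

text \<open>\<open>\<alpha> * \<beta>\<close> is \<open>\<beta>\<close> copies of \<open>\<alpha>\<close>, so that \<open>\<omega>\<^bsup>\<xi>+1\<^esup> = \<omega>\<^bsup>\<xi>\<^esup> * \<omega>\<close>.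
  The suprema below are over sets of at most \<open>\<aleph>\<^sub>1\<close> ordinals, hence bounded
  (see \<open>bdd_above_image_lessThan_ordinal\<close>).\<close>

instantiation ordinal :: "{plus, times}"
begin

definition plus_ordinal :: "ordinal \<Rightarrow> ordinal \<Rightarrow> ordinal"
  where "\<alpha> + \<beta> = orec \<alpha> osuc Sup \<beta>"

definition times_ordinal :: "ordinal \<Rightarrow> ordinal \<Rightarrow> ordinal"
  where "\<alpha> * \<beta> = orec 0 (\<lambda>\<gamma>. \<gamma> + \<alpha>) Sup \<beta>"

instance ..

end

lemma plus_ordinal_0: "\<alpha> + 0 = (\<alpha>::ordinal)"
  and plus_ordinal_osuc: "\<alpha> + osuc \<beta> = osuc (\<alpha> + \<beta>)"
  and plus_ordinal_limit: "limit_ordinal \<mu> \<Longrightarrow> \<alpha> + \<mu> = (SUP \<beta>\<in>{..<\<mu>}. \<alpha> + \<beta>)"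
  by (simp_all add: plus_ordinal_def orec_0 orec_osuc orec_limit)

lemma times_ordinal_0: "\<alpha> * 0 = (0::ordinal)"
  and times_ordinal_osuc: "\<alpha> * osuc \<beta> = \<alpha> * \<beta> + \<alpha>"
  and times_ordinal_limit: "limit_ordinal \<mu> \<Longrightarrow> \<alpha> * \<mu> = (SUP \<beta>\<in>{..<\<mu>}. \<alpha> * \<beta>)"
  by (simp_all add: times_ordinal_def orec_0 orec_osuc orec_limit)

definition omega :: ordinal
  where "omega = (LEAST \<alpha>. infinite {..<\<alpha>})"

definition omega1 :: ordinal
  where "omega1 = (LEAST \<alpha>. uncountable {..<\<alpha>})"

definition omega_pow :: "ordinal \<Rightarrow> ordinal"
  where "omega_pow \<xi> = orec 1 (\<lambda>\<gamma>. \<gamma> * omega) Sup \<xi>"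

lemma omega_pow_0: "omega_pow 0 = 1"
  and omega_pow_osuc: "omega_pow (osuc \<xi>) = omega_pow \<xi> * omega"
  and omega_pow_limit: "limit_ordinal \<xi> \<Longrightarrow> omega_pow \<xi> = (SUP \<eta>\<in>{..<\<xi>}. omega_pow \<eta>)"
  by (simp_all add: omega_pow_def orec_0 orec_osuc orec_limit)

lemma ex_uncountable_ordinal: "\<exists>\<alpha>::ordinal. uncountable {..<\<alpha>}"
proof -
  define F where "F = Field (cardSuc natLeq)"
  have co: "Card_order (cardSuc natLeq)" by (rule cardSuc_Card_order[OF natLeq_Card_order])
  have F: "|F| =o cardSuc natLeq" unfolding F_def by (rule card_of_Field_ordIso[OF co])
  have lt: "|F| <o omega2_rel" by (rule ordIso_ordLess_trans[OF F cardSuc_greater[OF co]])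
  then have "|F| <o |Field omega2_rel|"
    using ordIso_symmetric[OF card_of_Field_ordIso[OF Card_order_omega2_rel]]
    by (rule ordLess_ordIso_trans)
  then have "\<exists>h. inj_on h F \<and> h ` F \<subseteq> Field omega2_rel"
    by (intro card_of_ordLeq[THEN iffD2] ordLess_imp_ordLeq)
  then obtain h where h: "inj_on h F" "h ` F \<subseteq> Field omega2_rel" by (elim exE conjE)
  define A where "A = (Abs_ordinal \<circ> h) ` F"
  have inj: "inj_on (Abs_ordinal \<circ> h) F"
    using h by (intro comp_inj_on) (auto simp: inj_on_def Abs_ordinal_inject subset_iff)
  have "|A| <o omega2_rel"
    unfolding A_def by (rule ordLeq_ordLess_trans[OF card_of_image lt])
  from ex_greater_ordinal[OF this] obtain \<beta> where "\<forall>\<alpha>\<in>A. \<alpha> < \<beta>" ..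
  then have sub: "A \<subseteq> {..<\<beta>}" by auto
  have "uncountable F"
  proof
    assume "countable F"
    then obtain k :: "_ \<Rightarrow> nat" where "inj_on k F" by (rule countableE)
    then have "|F| \<le>o |UNIV::nat set|" by (intro card_of_ordLeq[THEN iffD1]) auto
    then have "|F| \<le>o natLeq" using card_of_nat by (rule ordLeq_ordIso_trans)
    then have "cardSuc natLeq \<le>o natLeq" by (rule ordIso_ordLeq_trans[OF ordIso_symmetric[OF F]])
    then show False using not_ordLess_ordLeq[OF cardSuc_greater[OF natLeq_Card_order]] by (rule notE[rotated])
  qed
  then have "uncountable A" unfolding A_def using countable_image_inj_on[OF _ inj] by (rule contrapos_nn)
  then have "uncountable {..<\<beta>}" using countable_subset[OF sub] by (rule contrapos_nn)
  then show ?thesis ..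
qed

lemma countable_ordinal_iff: "countable {..<\<alpha>} \<longleftrightarrow> \<alpha> < omega1"
proof
  show "\<alpha> < omega1" if "countable {..<\<alpha>}"
  proof (rule ccontr)
    assume "\<not> \<alpha> < omega1"
    then have "{..<omega1} \<subseteq> {..<\<alpha>}" by auto
    moreover have "uncountable {..<omega1}"
      unfolding omega1_def using ex_uncountable_ordinal by (rule LeastI_ex)
    ultimately show False using that countable_subset[of "{..<omega1}" "{..<\<alpha>}"] by simp
  qed
  show "countable {..<\<alpha>}" if "\<alpha> < omega1"
    using not_less_Least[of \<alpha> "\<lambda>\<alpha>. uncountable {..<\<alpha>}"] that by (simp add: omega1_def)
qed

unbundle no cardinal_syntax

text \<open>A function on \<open>K\<close> is represented by a total function of which only the values on \<open>K\<close>
  matter.\<close>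

definition Baire1 :: "'a::metric_space set \<Rightarrow> ('a \<Rightarrow> real) set"
  where "Baire1 K = {f. \<exists>F :: nat \<Rightarrow> 'a \<Rightarrow> real.
           (\<forall>n. continuous_on K (F n)) \<and> (\<forall>x\<in>K. (\<lambda>n. F n x) \<longlonglongrightarrow> f x)}"

definition osc_step :: "'a::metric_space set \<Rightarrow> ('a \<Rightarrow> real) \<Rightarrow> real \<Rightarrow> 'a set \<Rightarrow> 'a set"
  where "osc_step H f \<epsilon> A = {x\<in>A. \<forall>U. openin (top_of_set H) U \<and> x \<in> U \<longrightarrow>
           (\<exists>x\<^sub>1\<in>U \<inter> A. \<exists>x\<^sub>2\<in>U \<inter> A. \<bar>f x\<^sub>1 - f x\<^sub>2\<bar> \<ge> \<epsilon>)}"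

definition osc_derived :: "'a::metric_space set \<Rightarrow> ordinal \<Rightarrow> ('a \<Rightarrow> real) \<Rightarrow> real \<Rightarrow> 'a set"
  where "osc_derived H \<alpha> f \<epsilon> = orec H (osc_step H f \<epsilon>) Inter \<alpha>"

lemma osc_derived_0: "osc_derived H 0 f \<epsilon> = H"
  and osc_derived_osuc: "osc_derived H (osuc \<alpha>) f \<epsilon> = osc_step H f \<epsilon> (osc_derived H \<alpha> f \<epsilon>)"
  and osc_derived_limit:
    "limit_ordinal \<alpha> \<Longrightarrow> osc_derived H \<alpha> f \<epsilon> = (\<Inter>\<alpha>'\<in>{..<\<alpha>}. osc_derived H \<alpha>' f \<epsilon>)"
  by (simp_all add: osc_derived_def orec_0 orec_osuc orec_limit)

definition osc_index_at :: "'a::metric_space set \<Rightarrow> ('a \<Rightarrow> real) \<Rightarrow> real \<Rightarrow> ordinal"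
  where "osc_index_at H f \<epsilon> =
    (if \<exists>\<alpha>. countable {..<\<alpha>} \<and> osc_derived H \<alpha> f \<epsilon> = {}
     then LEAST \<alpha>. countable {..<\<alpha>} \<and> osc_derived H \<alpha> f \<epsilon> = {}
     else omega1)"

lemma osc_index_at_le: "osc_index_at H f \<epsilon> \<le> omega1"
proof (cases "\<exists>\<alpha>. countable {..<\<alpha>} \<and> osc_derived H \<alpha> f \<epsilon> = {}")
  case True
  from LeastI_ex[OF True] have "countable {..<osc_index_at H f \<epsilon>}"
    using True by (simp add: osc_index_at_def)
  then show ?thesis by (simp add: countable_ordinal_iff)
qed (auto simp: osc_index_at_def)

lemma bdd_above_osc_index_at: "bdd_above (osc_index_at H f ` E)"
  by (auto simp: bdd_above_def intro: osc_index_at_le)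

text \<open>The supremum is over a set bounded by \<open>\<omega>\<^sub>1\<close>.\<close>

definition osc_index :: "'a::metric_space set \<Rightarrow> ('a \<Rightarrow> real) \<Rightarrow> ordinal"
  where "osc_index H f = (SUP \<epsilon>\<in>{0<..}. osc_index_at H f \<epsilon>)"

definition Baire1_index :: "'a::metric_space set \<Rightarrow> ordinal \<Rightarrow> ('a \<Rightarrow> real) set"
  where "Baire1_index K \<xi> = {f \<in> Baire1 K. osc_index K f \<le> omega_pow \<xi>}"

end

theory Submission
  imports Defs
begin

text \<open>Why the theorem holds. That the derived sets of \<open>f\<close> for \<open>\<epsilon>\<close> have become empty at stage
  \<open>\<theta>\<close> can be expressed without iteration: there is a rank function \<open>r\<close> on \<open>K\<close> with values below
  \<open>\<theta>\<close> such that every \<open>x\<close> has a neighbourhood on which \<open>r \<le> r x\<close> and on whose part of rank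
  exactly \<open>r x\<close> the oscillation of \<open>f\<close> is less than \<open>\<epsilon>\<close>
  (\<open>ex_osc_rank\<close>, \<open>osc_rank_imp_osc_derived_empty\<close>). Estimates of oscillation indices thus become
  constructions of ranks.

  Two such constructions are needed. A rank of \<open>f\<close> and a rank of \<open>g\<close> combine by the natural
  (Hessenberg) sum to a rank of \<open>f + g\<close>. Powers of \<open>\<omega>\<close> are closed under the natural sum, so the
  functions of index at most \<open>\<omega>\<^bsup>\<xi>\<^esup>\<close> are closed under addition (\<open>osc_bounded_add\<close>). Secondly, if the
  level sets of some \<open>\<rho> < \<gamma>\<close> are locally exhausted within \<open>\<theta>\<close> derivations, then
  \<open>\<theta> * \<gamma>\<close> derivations exhaust \<open>K\<close> (\<open>osc_derived_times_rank\<close>).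

  Neither factor of the product is bounded, and estimating \<open>f * g\<close> directly on level sets on which
  both are locally bounded loses too much. The remedy is to split \<open>f = v + u\<close>, where \<open>\<bar>v\<bar> \<le> 1\<close> and
  \<open>u\<close> is continuous on each level set of a single rank \<open>r\<close> of \<open>f\<close>, namely one for
  \<open>\<epsilon> = 1\<close> (\<open>ex_approximation_continuous_on_levels\<close>). The rank \<open>r\<close> then serves \<open>u\<close> for every
  \<open>\<epsilon>\<close> at once, so the index of \<open>u\<close>, and with it that of \<open>v\<close>, is at most \<open>\<omega>\<^bsup>\<xi>\<^sub>1\<^esup>\<close>.

  For \<open>v * g\<close> the outer rank comes from \<open>g\<close>: as \<open>\<bar>v\<bar> \<le> 1\<close>, one rank of \<open>g\<close> controls the
  contribution of \<open>g\<close> everywhere, and on its level sets \<open>g\<close> is locally bounded, so that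
  \<open>\<omega>\<^bsup>\<xi>\<^sub>1\<^esup>\<close> derivations suffice there for the contribution of \<open>v\<close>. This gives the bound
  \<open>\<omega>\<^bsup>\<xi>\<^sub>1\<^esup> * \<omega>\<^bsup>\<xi>\<^sub>2\<^esup>\<close>. For \<open>u * g\<close> the outer rank is \<open>r\<close>: on its level sets \<open>u\<close> is continuous, so
  only \<open>g\<close> contributes, and the bound is \<open>\<omega>\<^bsup>\<xi>\<^sub>2\<^esup> * \<omega>\<^bsup>\<xi>\<^sub>1\<^esup>\<close>. These are the two
  exponents \<open>\<xi>\<^sub>1 + \<xi>\<^sub>2\<close> and \<open>\<xi>\<^sub>2 + \<xi>\<^sub>1\<close>; adding the two products gives the maximum.\<close>

section \<open>Ordinal arithmetic\<close>

lemma osuc_le_iff: "osuc \<alpha> \<le> \<beta> \<longleftrightarrow> \<alpha> < \<beta>"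
  by (meson less_osuc_iff not_le)

lemma lessThan_zero_ordinal [simp]: "{..<0::ordinal} = {}"
proof -
  have "\<not> \<alpha> < 0" for \<alpha> :: ordinal by (metis not_le zero_le_ordinal)
  then show ?thesis by blast
qed

lemma ordinal_cases:
  obtains (zero) "\<alpha> = (0::ordinal)" | (succ) \<gamma> where "\<alpha> = osuc \<gamma>" | (limit) "limit_ordinal \<alpha>"
  unfolding limit_ordinal_def by blast

lemma limit_ordinal_osuc_less: "limit_ordinal \<mu> \<Longrightarrow> \<alpha> < \<mu> \<Longrightarrow> osuc \<alpha> < \<mu>"
  unfolding limit_ordinal_def by (metis osuc_le_iff order_le_less)

lemma limit_ordinal_pos: "limit_ordinal \<mu> \<Longrightarrow> 0 < \<mu>"
  unfolding limit_ordinal_def by (metis zero_le_ordinal order_le_less)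

lemma ordinal_induct [case_names zero succ limit]:
  assumes "P 0"
    and "\<And>\<alpha>. P \<alpha> \<Longrightarrow> P (osuc \<alpha>)"
    and "\<And>\<mu>. limit_ordinal \<mu> \<Longrightarrow> (\<And>\<alpha>. \<alpha> < \<mu> \<Longrightarrow> P \<alpha>) \<Longrightarrow> P \<mu>"
  shows "P (\<alpha>::ordinal)"
proof (induction \<alpha> rule: less_induct)
  case (less \<alpha>)
  show ?case
    by (cases \<alpha> rule: ordinal_cases) (use less assms in auto)
qed

lemma limit_le_iff: "limit_ordinal \<mu> \<Longrightarrow> \<mu> \<le> \<beta> \<longleftrightarrow> (\<forall>\<alpha><\<mu>. \<alpha> \<le> \<beta>)"
  by (meson leI less_le_not_le limit_ordinal_osuc_less less_osuc order.strict_trans1 order_less_imp_le)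

text \<open>All the operations at hand are recursions that take suprema at limits; the following
  lemmas treat them uniformly.\<close>

definition continuous_at_limits :: "(ordinal \<Rightarrow> ordinal) \<Rightarrow> bool"
  where "continuous_at_limits F \<longleftrightarrow> (\<forall>\<mu>. limit_ordinal \<mu> \<longrightarrow> F \<mu> = (SUP \<beta>\<in>{..<\<mu>}. F \<beta>))"

lemma continuous_at_limits_le_iff:
  assumes "continuous_at_limits F" "limit_ordinal \<mu>"
  shows "F \<mu> \<le> \<gamma> \<longleftrightarrow> (\<forall>\<beta><\<mu>. F \<beta> \<le> \<gamma>)"
proof -
  have "{..<\<mu>} \<noteq> {}" using limit_ordinal_pos[OF assms(2)] by auto
  then have "(SUP \<beta>\<in>{..<\<mu>}. F \<beta>) \<le> \<gamma> \<longleftrightarrow> (\<forall>\<beta>\<in>{..<\<mu>}. F \<beta> \<le> \<gamma>)"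
    by (rule cSUP_le_iff[OF _ bdd_above_image_lessThan_ordinal])
  then show ?thesis using assms unfolding continuous_at_limits_def by (metis lessThan_iff)
qed

lemma continuous_at_limits_mono:
  assumes F: "continuous_at_limits F" and succ: "\<And>\<alpha>. F \<alpha> \<le> F (osuc \<alpha>)"
  shows "\<alpha> \<le> \<beta> \<Longrightarrow> F \<alpha> \<le> F \<beta>"
proof (induction \<beta> rule: ordinal_induct)
  case zero
  then show ?case by (metis order_antisym order_refl zero_le_ordinal)
next
  case (succ \<beta>)
  then show ?case
    by (metis assms(2) less_osuc_iff order_le_less order_trans)
next
  case (limit \<mu>)
  then show ?case
    using continuous_at_limits_le_iff[OF F limit(1), of "F \<mu>"] by (metis order_le_less order_refl)
qed

lemma continuous_at_limits_strict_mono: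
  assumes F: "continuous_at_limits F" and succ: "\<And>\<alpha>. F \<alpha> < F (osuc \<alpha>)" and "\<alpha> < \<beta>"
  shows "F \<alpha> < F \<beta>"
proof -
  have "F \<alpha> < F (osuc \<alpha>)" by (rule succ)
  also have "\<dots> \<le> F \<beta>"
    using continuous_at_limits_mono[OF F less_imp_le[OF succ]] assms(3) by (simp add: osuc_le_iff)
  finally show ?thesis .
qed

text \<open>If \<open>Sup A\<close> is not attained, it is a limit ordinal, and \<open>A\<close> is cofinal in it. This
  evaluates a continuous function at a nested supremum, such as \<open>\<alpha> * (\<beta> * \<mu>)\<close> for a limit \<open>\<mu>\<close>.\<close>

lemma continuous_at_limits_Sup_le:
  assumes F: "continuous_at_limits F" and mono: "\<And>\<alpha> \<beta>. \<alpha> \<le> \<beta> \<Longrightarrow> F \<alpha> \<le> F \<beta>"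
    and A: "A \<noteq> {}" "bdd_above A" and le: "\<And>\<alpha>. \<alpha> \<in> A \<Longrightarrow> F \<alpha> \<le> \<gamma>"
  shows "F (Sup A) \<le> \<gamma>"
proof (cases "Sup A \<in> A")
  case True
  then show ?thesis by (rule le)
next
  case False
  then have less: "\<alpha> < Sup A" if "\<alpha> \<in> A" for \<alpha>
    using cSup_upper[OF that A(2)] that by (metis order_le_less)
  have "Sup A \<noteq> 0"
    using less A(1) by (metis ex_in_conv not_le zero_le_ordinal)
  moreover have "Sup A \<noteq> osuc \<beta>" for \<beta>
  proof
    assume eq: "Sup A = osuc \<beta>"
    then have "Sup A \<le> \<beta>"
      using less A(1) by (intro cSup_least) (auto simp: less_osuc_iff)
    with eq show False by (metis less_osuc not_le)
  qed
  ultimately have "limit_ordinal (Sup A)" by (auto simp: limit_ordinal_def)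
  moreover have "F \<beta> \<le> \<gamma>" if "\<beta> < Sup A" for \<beta>
    using that A le mono by (metis less_cSup_iff less_imp_le order_trans)
  ultimately show ?thesis by (simp add: continuous_at_limits_le_iff[OF F])
qed

subsection \<open>Addition\<close>

lemma continuous_at_limits_plus: "continuous_at_limits (\<lambda>\<beta>. \<alpha> + \<beta>)"
  by (simp add: continuous_at_limits_def plus_ordinal_limit)

lemma plus_ordinal_strict_mono: "\<beta> < \<gamma> \<Longrightarrow> \<alpha> + \<beta> < \<alpha> + (\<gamma>::ordinal)"
  by (rule continuous_at_limits_strict_mono[OF continuous_at_limits_plus])
    (simp_all add: plus_ordinal_osuc)

lemma plus_ordinal_mono: "\<beta> \<le> \<gamma> \<Longrightarrow> \<alpha> + \<beta> \<le> \<alpha> + (\<gamma>::ordinal)"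
  by (metis order_le_less plus_ordinal_strict_mono)

lemma le_plus_ordinal: "\<alpha> \<le> \<alpha> + (\<beta>::ordinal)"
  by (metis plus_ordinal_0 plus_ordinal_mono zero_le_ordinal)

lemma plus_ordinal_mono_left: "\<alpha> \<le> \<alpha>' \<Longrightarrow> \<alpha> + \<beta> \<le> \<alpha>' + (\<beta>::ordinal)"
proof (induction \<beta> rule: ordinal_induct)
  case (succ \<beta>)
  then show ?case by (simp add: plus_ordinal_osuc osuc_le_iff less_osuc_iff)
next
  case (limit \<mu>)
  have "\<alpha> + \<beta> \<le> \<alpha>' + \<mu>" if "\<beta> < \<mu>" for \<beta>
    using limit that by (meson less_imp_le order_trans plus_ordinal_mono)
  then show ?case by (simp add: continuous_at_limits_le_iff[OF continuous_at_limits_plus limit(1)])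
qed (simp add: plus_ordinal_0)

lemma zero_plus_ordinal: "0 + \<alpha> = (\<alpha>::ordinal)"
proof (induction \<alpha> rule: ordinal_induct)
  case (limit \<mu>)
  have "(\<lambda>\<beta>. 0 + \<beta>) ` {..<\<mu>} = {..<\<mu>}"
    using limit(2) by (auto simp: image_iff)
  moreover have "Sup {..<\<mu>} = \<mu>"
  proof (rule cSup_eq_non_empty)
    show "{..<\<mu>} \<noteq> {}" using limit_ordinal_pos[OF limit(1)] by auto
    show "\<mu> \<le> \<beta>" if "\<And>\<alpha>. \<alpha> \<in> {..<\<mu>} \<Longrightarrow> \<alpha> \<le> \<beta>" for \<beta>
      using that by (simp add: limit_le_iff[OF limit(1)])
  qed auto
  ultimately show ?case by (simp add: plus_ordinal_limit[OF limit(1)])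
qed (simp_all add: plus_ordinal_0 plus_ordinal_osuc)

text \<open>This inequality and the similar ones for products below are oriented so that they bound a
  number of derivations from above. In this direction the limit case is just monotonicity.\<close>

lemma plus_ordinal_assoc_le: "(\<alpha> + \<beta>) + \<gamma> \<le> \<alpha> + (\<beta> + (\<gamma>::ordinal))"
proof (induction \<gamma> rule: ordinal_induct)
  case (succ \<gamma>)
  then show ?case by (simp add: plus_ordinal_osuc osuc_le_iff less_osuc_iff)
next
  case (limit \<mu>)
  have "(\<alpha> + \<beta>) + \<gamma> \<le> \<alpha> + (\<beta> + \<mu>)" if "\<gamma> < \<mu>" for \<gamma>
    using limit that by (meson less_imp_le order_trans plus_ordinal_mono)
  then show ?case by (simp add: continuous_at_limits_le_iff[OF continuous_at_limits_plus limit(1)])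
qed (simp add: plus_ordinal_0)

lemma limit_ordinal_plus: "limit_ordinal \<mu> \<Longrightarrow> limit_ordinal (\<alpha> + \<mu>)"
proof -
  assume \<mu>: "limit_ordinal \<mu>"
  have "\<alpha> + \<mu> \<noteq> 0"
    using plus_ordinal_strict_mono[OF limit_ordinal_pos[OF \<mu>], of \<alpha>] by (metis not_le zero_le_ordinal)
  moreover have "\<alpha> + \<mu> \<noteq> osuc \<gamma>" for \<gamma>
  proof
    assume eq: "\<alpha> + \<mu> = osuc \<gamma>"
    have "\<alpha> + \<beta> \<le> \<gamma>" if "\<beta> < \<mu>" for \<beta>
      using plus_ordinal_strict_mono[OF that, of \<alpha>] by (simp add: eq less_osuc_iff)
    then have "\<alpha> + \<mu> \<le> \<gamma>"
      by (simp add: continuous_at_limits_le_iff[OF continuous_at_limits_plus \<mu>])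
    with eq show False by (metis less_osuc not_le)
  qed
  ultimately show ?thesis by (auto simp: limit_ordinal_def)
qed

text \<open>The least \<open>\<delta>\<close> with \<open>\<beta> \<le> \<alpha> + \<delta>\<close> gives equality, by continuity of addition in \<open>\<delta>\<close>.\<close>

lemma ordinal_le_imp_plus:
  assumes "\<alpha> \<le> (\<beta>::ordinal)"
  shows "\<exists>\<delta>. \<beta> = \<alpha> + \<delta>"
proof -
  have "\<beta> \<le> \<alpha> + \<beta>"
    by (metis plus_ordinal_mono_left zero_le_ordinal zero_plus_ordinal)
  define \<delta> where "\<delta> = (LEAST \<delta>. \<beta> \<le> \<alpha> + \<delta>)"
  have \<delta>: "\<beta> \<le> \<alpha> + \<delta>" unfolding \<delta>_def using \<open>\<beta> \<le> \<alpha> + \<beta>\<close> by (rule LeastI)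
  have min: "\<alpha> + \<epsilon> < \<beta>" if "\<epsilon> < \<delta>" for \<epsilon>
    using not_less_Least[OF that[unfolded \<delta>_def]] by simp
  have "\<alpha> + \<delta> \<le> \<beta>"
  proof (cases \<delta> rule: ordinal_cases)
    case zero
    with assms show ?thesis by (simp add: plus_ordinal_0)
  next
    case (succ \<gamma>)
    with min[of \<gamma>] show ?thesis by (simp add: plus_ordinal_osuc osuc_le_iff)
  next
    case limit
    with min show ?thesis
      by (simp add: continuous_at_limits_le_iff[OF continuous_at_limits_plus] less_imp_le)
  qed
  with \<delta> show ?thesis by (metis order_antisym)
qed

subsection \<open>Multiplication and powers of \<open>\<omega>\<close>\<close>

lemma continuous_at_limits_times: "continuous_at_limits (\<lambda>\<beta>. \<alpha> * \<beta>)"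
  by (simp add: continuous_at_limits_def times_ordinal_limit)

lemma times_ordinal_mono: "\<beta> \<le> \<gamma> \<Longrightarrow> \<alpha> * \<beta> \<le> \<alpha> * (\<gamma>::ordinal)"
  by (rule continuous_at_limits_mono[OF continuous_at_limits_times])
    (simp_all add: times_ordinal_osuc le_plus_ordinal)

lemma times_ordinal_mono_left: "\<alpha> \<le> \<alpha>' \<Longrightarrow> \<alpha> * \<beta> \<le> \<alpha>' * (\<beta>::ordinal)"
proof (induction \<beta> rule: ordinal_induct)
  case (succ \<beta>)
  then show ?case
    by (simp add: times_ordinal_osuc) (meson order_trans plus_ordinal_mono plus_ordinal_mono_left)
next
  case (limit \<mu>)
  have "\<alpha> * \<beta> \<le> \<alpha>' * \<mu>" if "\<beta> < \<mu>" for \<beta>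
    using limit that by (meson less_imp_le order_trans times_ordinal_mono)
  then show ?case by (simp add: continuous_at_limits_le_iff[OF continuous_at_limits_times limit(1)])
qed (simp add: times_ordinal_0)

lemma times_ordinal_distrib_le: "\<alpha> * (\<beta> + \<gamma>) \<le> \<alpha> * \<beta> + \<alpha> * (\<gamma>::ordinal)"
proof (induction \<gamma> rule: ordinal_induct)
  case (succ \<gamma>)
  have "\<alpha> * (\<beta> + osuc \<gamma>) = \<alpha> * (\<beta> + \<gamma>) + \<alpha>" by (simp add: plus_ordinal_osuc times_ordinal_osuc)
  also have "\<dots> \<le> (\<alpha> * \<beta> + \<alpha> * \<gamma>) + \<alpha>" by (rule plus_ordinal_mono_left) (rule succ)
  also have "\<dots> \<le> \<alpha> * \<beta> + (\<alpha> * \<gamma> + \<alpha>)" by (rule plus_ordinal_assoc_le)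
  finally show ?case by (simp add: times_ordinal_osuc)
next
  case (limit \<mu>)
  have "\<alpha> * \<delta> \<le> \<alpha> * \<beta> + \<alpha> * \<mu>" if "\<delta> < \<beta> + \<mu>" for \<delta>
  proof -
    have "\<not> (\<forall>\<gamma><\<mu>. \<beta> + \<gamma> \<le> \<delta>)"
      using that continuous_at_limits_le_iff[OF continuous_at_limits_plus limit(1), of \<beta> \<delta>]
      by (metis not_le)
    then obtain \<gamma> where \<gamma>: "\<gamma> < \<mu>" "\<delta> < \<beta> + \<gamma>" by (meson not_le)
    have "\<alpha> * \<delta> \<le> \<alpha> * (\<beta> + \<gamma>)" using \<gamma> by (intro times_ordinal_mono) simp
    also have "\<dots> \<le> \<alpha> * \<beta> + \<alpha> * \<gamma>" using \<gamma> limit by simp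
    also have "\<dots> \<le> \<alpha> * \<beta> + \<alpha> * \<mu>" using \<gamma> by (intro plus_ordinal_mono times_ordinal_mono) simp
    finally show ?thesis .
  qed
  then show ?case
    by (simp add: continuous_at_limits_le_iff[OF continuous_at_limits_times limit_ordinal_plus[OF limit(1)]])
qed (simp add: plus_ordinal_0 times_ordinal_0)

lemma times_ordinal_assoc_le: "\<alpha> * (\<beta> * \<gamma>) \<le> (\<alpha> * \<beta>) * (\<gamma>::ordinal)"
proof (induction \<gamma> rule: ordinal_induct)
  case (succ \<gamma>)
  have "\<alpha> * (\<beta> * osuc \<gamma>) \<le> \<alpha> * (\<beta> * \<gamma>) + \<alpha> * \<beta>"
    by (simp add: times_ordinal_osuc times_ordinal_distrib_le)
  also have "\<dots> \<le> (\<alpha> * \<beta>) * osuc \<gamma>"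
    by (simp add: times_ordinal_osuc plus_ordinal_mono_left succ)
  finally show ?case .
next
  case (limit \<mu>)
  have "\<alpha> * (\<beta> * \<gamma>) \<le> (\<alpha> * \<beta>) * \<mu>" if "\<gamma> < \<mu>" for \<gamma>
    using limit that by (meson less_imp_le order_trans times_ordinal_mono)
  then have "\<alpha> * Sup ((\<lambda>\<gamma>. \<beta> * \<gamma>) ` {..<\<mu>}) \<le> (\<alpha> * \<beta>) * \<mu>"
    using limit_ordinal_pos[OF limit(1)]
    by (intro continuous_at_limits_Sup_le[OF continuous_at_limits_times] times_ordinal_mono
        bdd_above_image_lessThan_ordinal) auto
  then show ?case by (simp add: times_ordinal_limit[OF limit(1)])
qed (simp add: times_ordinal_0)

lemma less_one_ordinal_iff: "\<alpha> < (1::ordinal) \<longleftrightarrow> \<alpha> = 0"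
  unfolding one_ordinal_def less_osuc_iff by (metis order_antisym order_refl zero_le_ordinal)

lemma times_ordinal_one: "\<alpha> * 1 = (\<alpha>::ordinal)"
  by (simp add: one_ordinal_def times_ordinal_osuc times_ordinal_0 zero_plus_ordinal)

lemma infinite_lessThan_omega: "infinite {..<omega}"
proof -
  have "\<exists>\<alpha>::ordinal. infinite {..<\<alpha>}"
    using ex_uncountable_ordinal uncountable_infinite by blast
  then show ?thesis unfolding omega_def by (rule LeastI_ex)
qed

lemma less_omega_iff: "\<alpha> < omega \<longleftrightarrow> finite {..<\<alpha>}"
proof
  show "finite {..<\<alpha>}" if "\<alpha> < omega" using not_less_Least[OF that[unfolded omega_def]] by simp
  show "\<alpha> < omega" if "finite {..<\<alpha>}"
    using that infinite_lessThan_omega by (meson finite_subset lessThan_subset_iff not_le)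
qed

lemma lessThan_osuc: "{..<osuc \<alpha>} = insert \<alpha> {..<\<alpha>}"
  by (auto simp: less_osuc_iff)

lemma osuc_less_omega: "\<alpha> < omega \<Longrightarrow> osuc \<alpha> < omega"
  by (simp add: less_omega_iff lessThan_osuc)

lemma limit_ordinal_omega: "limit_ordinal omega"
proof -
  have "omega \<noteq> 0" by (metis finite.emptyI infinite_lessThan_omega lessThan_zero_ordinal)
  moreover have "omega \<noteq> osuc \<gamma>" for \<gamma>
    by (metis less_irrefl less_osuc osuc_less_omega)
  ultimately show ?thesis by (auto simp: limit_ordinal_def)
qed

lemma zero_less_omega: "0 < omega"
  by (rule limit_ordinal_pos[OF limit_ordinal_omega])

lemma le_times_omega: "\<alpha> \<le> \<alpha> * omega"
proof -
  have "1 \<le> omega" unfolding one_ordinal_def osuc_le_iff by (rule zero_less_omega)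
  from times_ordinal_mono[OF this, of \<alpha>] show ?thesis by (simp add: times_ordinal_one)
qed

lemma continuous_at_limits_omega_pow: "continuous_at_limits omega_pow"
  by (simp add: continuous_at_limits_def omega_pow_limit)

lemma omega_pow_mono: "\<alpha> \<le> \<beta> \<Longrightarrow> omega_pow \<alpha> \<le> omega_pow \<beta>"
  by (rule continuous_at_limits_mono[OF continuous_at_limits_omega_pow])
    (simp_all add: omega_pow_osuc le_times_omega)

lemma omega_pow_pos: "0 < omega_pow \<alpha>"
  using omega_pow_mono[of 0 \<alpha>] by (simp add: omega_pow_0 one_ordinal_def osuc_le_iff)

lemma omega_pow_times_le: "omega_pow \<alpha> * omega_pow \<beta> \<le> omega_pow (\<alpha> + \<beta>)"
proof (induction \<beta> rule: ordinal_induct)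
  case zero
  show ?case by (simp add: omega_pow_0 times_ordinal_one plus_ordinal_0)
next
  case (succ \<beta>)
  have "omega_pow \<alpha> * omega_pow (osuc \<beta>) \<le> (omega_pow \<alpha> * omega_pow \<beta>) * omega"
    by (simp add: omega_pow_osuc times_ordinal_assoc_le)
  also have "\<dots> \<le> omega_pow (\<alpha> + \<beta>) * omega" by (rule times_ordinal_mono_left) (rule succ)
  finally show ?case by (simp add: omega_pow_osuc plus_ordinal_osuc)
next
  case (limit \<mu>)
  have "omega_pow \<alpha> * omega_pow \<beta> \<le> omega_pow (\<alpha> + \<mu>)" if "\<beta> < \<mu>" for \<beta>
    using limit that by (meson less_imp_le omega_pow_mono order_trans plus_ordinal_mono)
  then have "omega_pow \<alpha> * Sup (omega_pow ` {..<\<mu>}) \<le> omega_pow (\<alpha> + \<mu>)"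
    using limit_ordinal_pos[OF limit(1)]
    by (intro continuous_at_limits_Sup_le[OF continuous_at_limits_times] times_ordinal_mono
        bdd_above_image_lessThan_ordinal) auto
  then show ?case by (simp add: omega_pow_limit[OF limit(1)])
qed

subsection \<open>Countability\<close>

lemma countable_lessThan_le: "\<alpha> \<le> \<beta> \<Longrightarrow> countable {..<\<beta>} \<Longrightarrow> countable {..<\<alpha>::ordinal}"
  by (meson countable_subset lessThan_subset_iff)

text \<open>A countable supremum of countable ordinals is countable.\<close>

lemma countable_lessThan_continuous:
  assumes F: "continuous_at_limits F" and zero: "countable {..<F 0}"
    and succ: "\<And>\<alpha>. countable {..<F \<alpha>} \<Longrightarrow> countable {..<F (osuc \<alpha>)}"
    and "countable {..<\<alpha>}"
  shows "countable {..<F \<alpha>}"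
  using \<open>countable {..<\<alpha>}\<close>
proof (induction \<alpha> rule: ordinal_induct)
  case zero
  show ?case by (rule assms)
next
  case (succ \<alpha>)
  then show ?case by (simp add: assms(3) lessThan_osuc)
next
  case (limit \<mu>)
  have "{..<F \<mu>} \<subseteq> (\<Union>\<beta>\<in>{..<\<mu>}. {..<F \<beta>})"
  proof
    fix \<gamma> assume "\<gamma> \<in> {..<F \<mu>}"
    then have "\<not> F \<mu> \<le> \<gamma>" by simp
    then obtain \<beta> where "\<beta> < \<mu>" "\<not> F \<beta> \<le> \<gamma>"
      using continuous_at_limits_le_iff[OF F limit(1)] by blast
    then show "\<gamma> \<in> (\<Union>\<beta>\<in>{..<\<mu>}. {..<F \<beta>})" by (meson UN_I lessThan_iff not_le)
  qed
  moreover have "countable {..<F \<beta>}" if "\<beta> < \<mu>" for \<beta>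
    using limit that countable_lessThan_le[of \<beta> \<mu>] by simp
  ultimately show ?case
    using limit.prems by (meson countable_UN countable_subset lessThan_iff)
qed

lemma countable_plus_ordinal:
  "countable {..<\<alpha>} \<Longrightarrow> countable {..<\<beta>} \<Longrightarrow> countable {..<\<alpha> + \<beta>::ordinal}"
  by (rule countable_lessThan_continuous[OF continuous_at_limits_plus])
    (simp_all add: plus_ordinal_0 plus_ordinal_osuc lessThan_osuc)

lemma countable_times_ordinal:
  "countable {..<\<alpha>} \<Longrightarrow> countable {..<\<beta>} \<Longrightarrow> countable {..<\<alpha> * \<beta>::ordinal}"
  by (rule countable_lessThan_continuous[OF continuous_at_limits_times])
    (simp_all add: times_ordinal_0 times_ordinal_osuc countable_plus_ordinal)

lemma countable_lessThan_omega: "countable {..<omega}"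
proof (rule countableI')
  show "inj_on (\<lambda>\<alpha>. card {..<\<alpha>}) {..<omega}"
  proof (rule linorder_inj_onI)
    fix \<alpha> \<beta> assume "\<alpha> < \<beta>" "\<alpha> \<in> {..<omega}" "\<beta> \<in> {..<omega}"
    then have "card {..<\<alpha>} < card {..<\<beta>}"
      by (intro psubset_card_mono) (auto simp: less_omega_iff)
    then show "card {..<\<alpha>} \<noteq> card {..<\<beta>}" by simp
  qed auto
qed

lemma countable_omega_pow: "countable {..<\<xi>} \<Longrightarrow> countable {..<omega_pow \<xi>}"
  by (rule countable_lessThan_continuous[OF continuous_at_limits_omega_pow])
    (simp_all add: omega_pow_0 omega_pow_osuc countable_times_ordinal countable_lessThan_omega
      one_ordinal_def lessThan_osuc)

section \<open>The natural sum\<close>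

text \<open>This is the Hessenberg sum, characterised as the least function that is strictly increasing in
  each argument. Strict monotonicity is what makes it combine ranks, minimality is what bounds it.\<close>

function nsum :: "ordinal \<Rightarrow> ordinal \<Rightarrow> ordinal" where
  "nsum \<alpha> \<beta> = Sup (osuc ` ((\<lambda>\<alpha>'. nsum \<alpha>' \<beta>) ` {..<\<alpha>} \<union> nsum \<alpha> ` {..<\<beta>}))"
  by auto
termination
  by (relation "{(x, y). x < y} <*lex*> {(x, y). x < y}") (auto intro: wf)

declare nsum.simps [simp del]

lemma bdd_above_nsum: "bdd_above (osuc ` ((\<lambda>\<alpha>'. nsum \<alpha>' \<beta>) ` {..<\<alpha>} \<union> nsum \<alpha> ` {..<\<beta>}))"
  by (simp add: image_Un image_image bdd_above_image_lessThan_ordinal)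

lemma nsum_strict_mono_left: "\<alpha>' < \<alpha> \<Longrightarrow> nsum \<alpha>' \<beta> < nsum \<alpha> \<beta>"
  unfolding osuc_le_iff[symmetric] nsum.simps[of \<alpha> \<beta>]
  by (rule cSup_upper[OF _ bdd_above_nsum]) (auto simp: less_osuc_iff osuc_le_iff)

lemma nsum_strict_mono_right: "\<beta>' < \<beta> \<Longrightarrow> nsum \<alpha> \<beta>' < nsum \<alpha> \<beta>"
  unfolding osuc_le_iff[symmetric] nsum.simps[of \<alpha> \<beta>]
  by (rule cSup_upper[OF _ bdd_above_nsum]) (auto simp: less_osuc_iff osuc_le_iff)

lemma nsum_least:
  assumes "\<And>\<alpha>'. \<alpha>' < \<alpha> \<Longrightarrow> nsum \<alpha>' \<beta> < \<gamma>" and "\<And>\<beta>'. \<beta>' < \<beta> \<Longrightarrow> nsum \<alpha> \<beta>' < \<gamma>"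
  shows "nsum \<alpha> \<beta> \<le> \<gamma>"
proof (cases "{..<\<alpha>} = {} \<and> {..<\<beta>} = {}")
  case True
  then have "nsum \<alpha> \<beta> = 0"
    by (simp add: nsum.simps[of \<alpha> \<beta>] Sup_ordinal_def zero_ordinal_def)
  then show ?thesis by simp
next
  case False
  show ?thesis
    unfolding nsum.simps[of \<alpha> \<beta>]
    by (rule cSup_least) (use assms False in \<open>auto simp: osuc_le_iff\<close>)
qed

lemma nsum_mono: "\<alpha> \<le> \<alpha>' \<Longrightarrow> \<beta> \<le> \<beta>' \<Longrightarrow> nsum \<alpha> \<beta> \<le> nsum \<alpha>' \<beta>'"
  by (metis nsum_strict_mono_left nsum_strict_mono_right order_le_less order_less_imp_le order_trans)

lemma nsum_le_cancel:
  assumes "nsum \<alpha>' \<beta>' \<le> nsum \<alpha> \<beta>" "\<alpha> \<le> \<alpha>'" "\<beta> \<le> \<beta>'"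
  shows "\<alpha>' = \<alpha> \<and> \<beta>' = \<beta>"
  using assms
  by (metis nsum_mono nsum_strict_mono_left nsum_strict_mono_right order_le_less order_less_le_trans not_le order_refl)

lemma nsum_le_strict_mono:
  assumes "\<And>\<alpha> \<alpha>' \<beta>. \<alpha>' < \<alpha> \<Longrightarrow> \<alpha> < \<theta> \<Longrightarrow> \<beta> < \<theta> \<Longrightarrow> \<tau> \<alpha>' \<beta> < \<tau> \<alpha> \<beta>"
    and "\<And>\<alpha> \<beta> \<beta>'. \<beta>' < \<beta> \<Longrightarrow> \<alpha> < \<theta> \<Longrightarrow> \<beta> < \<theta> \<Longrightarrow> \<tau> \<alpha> \<beta>' < \<tau> \<alpha> \<beta>"
  shows "\<alpha> < \<theta> \<Longrightarrow> \<beta> < \<theta> \<Longrightarrow> nsum \<alpha> \<beta> \<le> \<tau> \<alpha> \<beta>"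
proof (induction \<alpha> \<beta> rule: nsum.induct)
  case (1 \<alpha> \<beta>)
  show ?case
  proof (rule nsum_least)
    show "nsum \<alpha>' \<beta> < \<tau> \<alpha> \<beta>" if "\<alpha>' < \<alpha>" for \<alpha>'
      using 1(1)[of \<alpha>'] 1(3,4) assms(1)[OF that 1(3,4)] that
      by (metis lessThan_iff order_le_less_trans order_less_trans)
    show "nsum \<alpha> \<beta>' < \<tau> \<alpha> \<beta>" if "\<beta>' < \<beta>" for \<beta>'
      using 1(2)[of \<beta>'] 1(3,4) assms(2)[OF that 1(3,4)] that
      by (metis lessThan_iff order_le_less_trans order_less_trans)
  qed
qed

text \<open>The product \<open>\<theta> * n\<close> for a natural number \<open>n\<close>, so that the quotients of a division by \<open>\<theta>\<close>
  can be added as natural numbers.\<close>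

definition multiple :: "ordinal \<Rightarrow> nat \<Rightarrow> ordinal"
  where "multiple \<theta> n = ((\<lambda>\<gamma>. \<gamma> + \<theta>) ^^ n) 0"

lemma multiple_0: "multiple \<theta> 0 = 0" and multiple_Suc: "multiple \<theta> (Suc n) = multiple \<theta> n + \<theta>"
  by (simp_all add: multiple_def)

lemma multiple_mono: "m \<le> n \<Longrightarrow> multiple \<theta> m \<le> multiple \<theta> n"
  by (rule lift_Suc_mono_le[of "multiple \<theta>"]) (simp_all add: multiple_Suc le_plus_ordinal)

lemma multiple_eq_times: "\<exists>\<nu><omega. multiple \<theta> n = \<theta> * \<nu>"
proof (induction n)
  case 0
  show ?case using zero_less_omega by (metis multiple_0 times_ordinal_0)
next
  case (Suc n)
  then show ?case by (metis multiple_Suc osuc_less_omega times_ordinal_osuc)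
qed

lemma multiple_le_times_omega: "multiple \<theta> n \<le> \<theta> * omega"
  using multiple_eq_times[of \<theta> n] by (metis order_less_imp_le times_ordinal_mono)

lemma less_times_omega_multiple:
  assumes "\<alpha> < \<theta> * omega"
  shows "\<exists>n. \<alpha> < multiple \<theta> n"
proof -
  have fin: "\<exists>n. \<theta> * \<nu> = multiple \<theta> n" if "\<nu> < omega" for \<nu>
    using that
  proof (induction \<nu> rule: ordinal_induct)
    case zero
    show ?case by (metis multiple_0 times_ordinal_0)
  next
    case (succ \<nu>)
    then show ?case by (metis less_osuc multiple_Suc order_less_trans times_ordinal_osuc)
  next
    case (limit \<mu>)
    have "\<nu> < Max {..<\<mu>}" if "\<nu> \<in> {..<\<mu>}" for \<nu>
    proof -
      have "osuc \<nu> \<le> Max {..<\<mu>}"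
        using limit that by (intro Max_ge) (auto simp: less_omega_iff limit_ordinal_osuc_less)
      then show ?thesis by (simp add: osuc_le_iff)
    qed
    moreover have "Max {..<\<mu>} \<in> {..<\<mu>}"
      using limit limit_ordinal_pos[of \<mu>] by (intro Max_in) (auto simp: less_omega_iff)
    ultimately show ?case by blast
  qed
  have "\<not> (\<forall>\<nu><omega. \<theta> * \<nu> \<le> \<alpha>)"
    using assms continuous_at_limits_le_iff[OF continuous_at_limits_times limit_ordinal_omega, of \<theta> \<alpha>]
    by (metis not_le)
  then show ?thesis using fin by (metis not_le)
qed

text \<open>Each \<open>\<alpha> < \<theta> * \<omega>\<close> is \<open>\<theta> * q + \<rho>\<close> with a natural number \<open>q\<close> and a remainder \<open>\<rho> < \<theta>\<close>. Adding the
  quotients as natural numbers and the remainders by the natural sum yields a function that is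
  strictly increasing in each argument and stays below \<open>\<theta> * \<omega>\<close>; by minimality it dominates
  the natural sum.\<close>

lemma nsum_less_times_omega:
  assumes \<theta>: "0 < \<theta>" and closed: "\<And>\<alpha> \<beta>. \<alpha> < \<theta> \<Longrightarrow> \<beta> < \<theta> \<Longrightarrow> nsum \<alpha> \<beta> < \<theta>"
    and "\<alpha> < \<theta> * omega" "\<beta> < \<theta> * omega"
  shows "nsum \<alpha> \<beta> < \<theta> * omega"
proof -
  define q where "q \<alpha> = (LEAST n. \<alpha> < multiple \<theta> (Suc n))" for \<alpha>
  define r where "r \<alpha> = (SOME \<rho>. \<alpha> = multiple \<theta> (q \<alpha>) + \<rho>)" for \<alpha>
  have upper: "\<alpha> < multiple \<theta> (Suc (q \<alpha>))" if "\<alpha> < \<theta> * omega" for \<alpha>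
  proof -
    from less_times_omega_multiple[OF that] obtain n where "\<alpha> < multiple \<theta> n" ..
    then have "\<alpha> < multiple \<theta> (Suc n)"
      using multiple_mono[of n "Suc n" \<theta>] by (meson le_SucI order_less_le_trans order_refl)
    then show ?thesis unfolding q_def by (rule LeastI)
  qed
  have lower: "multiple \<theta> (q \<alpha>) \<le> \<alpha>" if "\<alpha> < \<theta> * omega" for \<alpha>
  proof (cases "q \<alpha>")
    case (Suc n)
    then have "\<not> \<alpha> < multiple \<theta> (Suc n)" unfolding q_def by (intro not_less_Least) simp
    then show ?thesis by (simp add: Suc not_less)
  qed (simp add: multiple_0)
  have decomp: "\<alpha> = multiple \<theta> (q \<alpha>) + r \<alpha>" if "\<alpha> < \<theta> * omega" for \<alpha>
    unfolding r_def by (rule someI_ex[OF ordinal_le_imp_plus[OF lower[OF that]]])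
  have r: "r \<alpha> < \<theta>" if "\<alpha> < \<theta> * omega" for \<alpha>
    using upper[OF that] decomp[OF that] by (metis multiple_Suc not_le plus_ordinal_mono)
  have q_mono: "q \<alpha>' \<le> q \<alpha>" if "\<alpha>' < \<alpha>" "\<alpha> < \<theta> * omega" for \<alpha> \<alpha>'
    unfolding q_def[of \<alpha>'] by (rule Least_le) (meson upper that order_less_trans)
  have r_less: "r \<alpha>' < r \<alpha>" if "\<alpha>' < \<alpha>" "\<alpha> < \<theta> * omega" "q \<alpha>' = q \<alpha>" for \<alpha> \<alpha>'
    using decomp[of \<alpha>] decomp[of \<alpha>'] that by (metis not_le order_less_trans plus_ordinal_mono)
  define \<tau> where "\<tau> \<alpha> \<beta> = multiple \<theta> (q \<alpha> + q \<beta>) + nsum (r \<alpha>) (r \<beta>)" for \<alpha> \<beta>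
  have less_next: "multiple \<theta> m + nsum (r \<alpha>) (r \<beta>) < multiple \<theta> n"
    if "m < n" "\<alpha> < \<theta> * omega" "\<beta> < \<theta> * omega" for m n \<alpha> \<beta>
  proof -
    have "multiple \<theta> m + nsum (r \<alpha>) (r \<beta>) < multiple \<theta> (Suc m)"
      using that closed r by (simp add: multiple_Suc plus_ordinal_strict_mono)
    also have "\<dots> \<le> multiple \<theta> n" using that by (intro multiple_mono) simp
    finally show ?thesis .
  qed
  have "nsum \<alpha> \<beta> \<le> \<tau> \<alpha> \<beta>"
  proof (rule nsum_le_strict_mono[of "\<theta> * omega"])
    fix \<alpha> \<alpha>' \<beta> assume *: "\<alpha>' < \<alpha>" "\<alpha> < \<theta> * omega" "\<beta> < \<theta> * omega"
    then have **: "\<alpha>' < \<theta> * omega" by simp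
    show "\<tau> \<alpha>' \<beta> < \<tau> \<alpha> \<beta>"
    proof (cases "q \<alpha>' = q \<alpha>")
      case True
      with r_less[OF *(1,2)] show ?thesis
        by (simp add: \<tau>_def plus_ordinal_strict_mono nsum_strict_mono_left)
    next
      case False
      with q_mono[OF *(1,2)] have "q \<alpha>' + q \<beta> < q \<alpha> + q \<beta>" by simp
      from less_next[OF this ** *(3)] show ?thesis
        unfolding \<tau>_def using le_plus_ordinal by (rule order_less_le_trans)
    qed
  next
    fix \<alpha> \<beta>' \<beta> assume *: "\<beta>' < \<beta>" "\<alpha> < \<theta> * omega" "\<beta> < \<theta> * omega"
    then have **: "\<beta>' < \<theta> * omega" by simp
    show "\<tau> \<alpha> \<beta>' < \<tau> \<alpha> \<beta>"
    proof (cases "q \<beta>' = q \<beta>")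
      case True
      with r_less[OF *(1,3)] show ?thesis
        by (simp add: \<tau>_def plus_ordinal_strict_mono nsum_strict_mono_right)
    next
      case False
      with q_mono[OF *(1,3)] have "q \<alpha> + q \<beta>' < q \<alpha> + q \<beta>" by simp
      from less_next[OF this *(2) **] show ?thesis
        unfolding \<tau>_def using le_plus_ordinal by (rule order_less_le_trans)
    qed
  qed (use assms in auto)
  also have "\<tau> \<alpha> \<beta> < multiple \<theta> (Suc (q \<alpha> + q \<beta>))"
    unfolding \<tau>_def using assms by (intro less_next) auto
  also have "\<dots> \<le> \<theta> * omega" by (rule multiple_le_times_omega)
  finally show ?thesis .
qed

lemma nsum_less_omega_pow:
  "\<alpha> < omega_pow \<xi> \<Longrightarrow> \<beta> < omega_pow \<xi> \<Longrightarrow> nsum \<alpha> \<beta> < omega_pow \<xi>"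
proof (induction \<xi> arbitrary: \<alpha> \<beta> rule: ordinal_induct)
  case zero
  have "nsum 0 0 \<le> 0" by (rule nsum_least) (metis not_le zero_le_ordinal)+
  then have "nsum 0 0 < 1" by (simp add: one_ordinal_def less_osuc_iff)
  with zero show ?case by (simp add: omega_pow_0 less_one_ordinal_iff)
next
  case (succ \<xi>)
  then show ?case by (simp add: omega_pow_osuc nsum_less_times_omega omega_pow_pos)
next
  case (limit \<mu>)
  have "\<exists>\<eta><\<mu>. \<gamma> < omega_pow \<eta>" if "\<gamma> < omega_pow \<mu>" for \<gamma>
    using that continuous_at_limits_le_iff[OF continuous_at_limits_omega_pow limit(1)] by (metis not_le)
  with limit.prems obtain \<eta> \<eta>' where \<eta>: "\<eta> < \<mu>" "\<alpha> < omega_pow \<eta>" "\<eta>' < \<mu>" "\<beta> < omega_pow \<eta>'"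
    by metis
  then have "\<alpha> < omega_pow (max \<eta> \<eta>')" "\<beta> < omega_pow (max \<eta> \<eta>')"
    by (metis omega_pow_mono max.cobounded1 order_less_le_trans,
        metis \<eta>(4) omega_pow_mono max.cobounded2 order_less_le_trans)
  moreover have "max \<eta> \<eta>' < \<mu>" using \<eta> by simp
  ultimately have "nsum \<alpha> \<beta> < omega_pow (max \<eta> \<eta>')" using limit(2) by blast
  also have "\<dots> \<le> omega_pow \<mu>" using \<open>max \<eta> \<eta>' < \<mu>\<close> by (intro omega_pow_mono less_imp_le)
  finally show ?case .
qed

section \<open>Derived sets and rank functions\<close>

lemma osc_step_subset: "osc_step H f \<epsilon> A \<subseteq> A"
  by (auto simp: osc_step_def)

lemma osc_derived_antimono:
  "\<alpha> \<le> \<beta> \<Longrightarrow> osc_derived H \<beta> f \<epsilon> \<subseteq> osc_derived H \<alpha> f \<epsilon>"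
proof (induction \<beta> rule: ordinal_induct)
  case zero
  then show ?case by (metis order_antisym order_refl zero_le_ordinal)
next
  case (succ \<beta>)
  show ?case
  proof (cases "\<alpha> = osuc \<beta>")
    case False
    with succ.prems have "\<alpha> \<le> \<beta>" by (metis less_osuc_iff order_le_less)
    with succ.IH show ?thesis by (metis osc_derived_osuc osc_step_subset subset_trans)
  qed simp
next
  case (limit \<mu>)
  then show ?case by (cases "\<alpha> = \<mu>") (auto simp: osc_derived_limit)
qed

lemma osc_derived_subset: "osc_derived H \<alpha> f \<epsilon> \<subseteq> H"
  using osc_derived_antimono[of 0 \<alpha>] by (simp add: osc_derived_0)

text \<open>For uncountable \<open>\<theta>\<close> this can fail, since \<open>\<omega>\<^sub>1\<close> is also the index of functions whose derived sets
  never become empty.\<close>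

lemma osc_index_le_iff:
  assumes "countable {..<\<theta>}"
  shows "osc_index H f \<le> \<theta> \<longleftrightarrow> (\<forall>\<epsilon>>0. osc_derived H \<theta> f \<epsilon> = {})"
proof -
  have "osc_index_at H f \<epsilon> \<le> \<theta> \<longleftrightarrow> osc_derived H \<theta> f \<epsilon> = {}" for \<epsilon>
  proof
    assume le: "osc_index_at H f \<epsilon> \<le> \<theta>"
    have "\<exists>\<alpha>. countable {..<\<alpha>} \<and> osc_derived H \<alpha> f \<epsilon> = {}"
    proof (rule ccontr)
      assume "\<not> ?thesis"
      then have "omega1 \<le> \<theta>" using le unfolding osc_index_at_def by (simp split: if_splits)
      with assms show False by (simp add: countable_ordinal_iff)
    qed
    from LeastI_ex[OF this] this have "osc_derived H (osc_index_at H f \<epsilon>) f \<epsilon> = {}"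
      by (simp add: osc_index_at_def)
    with osc_derived_antimono[OF le, of H f \<epsilon>] show "osc_derived H \<theta> f \<epsilon> = {}" by simp
  next
    assume "osc_derived H \<theta> f \<epsilon> = {}"
    with assms show "osc_index_at H f \<epsilon> \<le> \<theta>"
      unfolding osc_index_at_def by (auto intro: Least_le)
  qed
  moreover have "osc_index H f \<le> \<theta> \<longleftrightarrow> (\<forall>\<epsilon>\<in>{0<..}. osc_index_at H f \<epsilon> \<le> \<theta>)"
    unfolding osc_index_def by (rule cSUP_le_iff[OF _ bdd_above_osc_index_at]) auto
  ultimately show ?thesis by auto
qed

definition osc_rank :: "'a::metric_space set \<Rightarrow> ('a \<Rightarrow> real) \<Rightarrow> real \<Rightarrow> ('a \<Rightarrow> ordinal) \<Rightarrow> bool"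
  where "osc_rank K f \<epsilon> r \<longleftrightarrow> (\<forall>x\<in>K. \<exists>U. openin (top_of_set K) U \<and> x \<in> U \<and>
           (\<forall>y\<in>U. r y \<le> r x) \<and> (\<forall>y\<in>U. \<forall>z\<in>U. r y = r x \<longrightarrow> r z = r x \<longrightarrow> \<bar>f y - f z\<bar> < \<epsilon>))"

lemma osc_rankE:
  assumes "osc_rank K f \<epsilon> r" "x \<in> K"
  obtains U where "openin (top_of_set K) U" "x \<in> U" "\<And>y. y \<in> U \<Longrightarrow> r y \<le> r x"
    "\<And>y z. y \<in> U \<Longrightarrow> z \<in> U \<Longrightarrow> r y = r x \<Longrightarrow> r z = r x \<Longrightarrow> \<bar>f y - f z\<bar> < \<epsilon>"
  using assms unfolding osc_rank_def by meson

text \<open>The rank of \<open>x\<close> is the last stage whose derived set still contains \<open>x\<close>; it exists because a point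
  that survives all stages below a limit survives the limit. A neighbourhood that witnesses the
  removal of \<open>x\<close> removes with it all other points of that stage, so no point in it has larger rank.\<close>

lemma ex_osc_rank:
  assumes empty: "osc_derived K \<theta> f \<epsilon> = {}"
  shows "\<exists>r. (\<forall>x\<in>K. r x < \<theta>) \<and> osc_rank K f \<epsilon> r"
proof -
  let ?D = "\<lambda>\<alpha>. osc_derived K \<alpha> f \<epsilon>"
  have "\<exists>\<alpha><\<theta>. x \<in> ?D \<alpha> \<and> x \<notin> ?D (osuc \<alpha>)" if x: "x \<in> K" for x
  proof -
    define \<beta> where "\<beta> = (LEAST \<beta>. x \<notin> ?D \<beta>)"
    have "x \<notin> ?D \<theta>" using empty by simp
    then have \<beta>: "x \<notin> ?D \<beta>" "\<beta> \<le> \<theta>" unfolding \<beta>_def by (rule LeastI, rule Least_le)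
    have below: "x \<in> ?D \<alpha>" if "\<alpha> < \<beta>" for \<alpha>
      using not_less_Least[OF that[unfolded \<beta>_def]] by simp
    show ?thesis
    proof (cases \<beta> rule: ordinal_cases)
      case zero
      with \<beta>(1) x show ?thesis by (simp add: osc_derived_0)
    next
      case (succ \<alpha>)
      with \<beta> below[of \<alpha>] show ?thesis by (auto simp: osuc_le_iff)
    next
      case limit
      with \<beta>(1) below show ?thesis by (auto simp: osc_derived_limit)
    qed
  qed
  then obtain r where r: "\<And>x. x \<in> K \<Longrightarrow> r x < \<theta> \<and> x \<in> ?D (r x) \<and> x \<notin> ?D (osuc (r x))"
    by metis
  have "\<exists>U. openin (top_of_set K) U \<and> x \<in> U \<and> (\<forall>y\<in>U. r y \<le> r x) \<and>
      (\<forall>y\<in>U. \<forall>z\<in>U. r y = r x \<longrightarrow> r z = r x \<longrightarrow> \<bar>f y - f z\<bar> < \<epsilon>)" if x: "x \<in> K" for x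
  proof -
    obtain U where U: "openin (top_of_set K) U" "x \<in> U"
      and osc: "\<And>y z. y \<in> U \<inter> ?D (r x) \<Longrightarrow> z \<in> U \<inter> ?D (r x) \<Longrightarrow> \<bar>f y - f z\<bar> < \<epsilon>"
      using r[OF x] unfolding osc_derived_osuc osc_step_def by (auto simp: not_le)
    have UK: "U \<subseteq> K" using U(1) by (rule openin_imp_subset)
    have "r y \<le> r x" if y: "y \<in> U" for y
    proof (rule ccontr)
      assume "\<not> r y \<le> r x"
      then have "osuc (r x) \<le> r y" by (simp add: osuc_le_iff)
      then have "y \<in> ?D (osuc (r x))" using r UK y osc_derived_antimono by blast
      then obtain z w where "z \<in> U \<inter> ?D (r x)" "w \<in> U \<inter> ?D (r x)" "\<bar>f z - f w\<bar> \<ge> \<epsilon>"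
        using U(1) y unfolding osc_derived_osuc osc_step_def by blast
      with osc[of z w] show False by simp
    qed
    moreover have "\<bar>f y - f z\<bar> < \<epsilon>" if "y \<in> U" "z \<in> U" "r y = r x" "r z = r x" for y z
      using that r UK by (intro osc) (metis IntI subsetD)+
    ultimately show ?thesis using U by blast
  qed
  then have "osc_rank K f \<epsilon> r" unfolding osc_rank_def by blast
  with r show ?thesis by blast
qed

text \<open>A rank that lives only on a part \<open>T\<close> of \<open>K\<close>, and that may be large near a point: the oscillation
  is controlled on the points of at least the given rank. This form is inherited by every subset of \<open>T\<close>
  and is all that bounding derived sets requires.\<close>

definition weak_osc_rank ::
    "'a::metric_space set \<Rightarrow> 'a set \<Rightarrow> ('a \<Rightarrow> real) \<Rightarrow> real \<Rightarrow> ('a \<Rightarrow> ordinal) \<Rightarrow> bool"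
  where "weak_osc_rank K T h \<epsilon> \<tau> \<longleftrightarrow> (\<forall>y\<in>T. \<exists>V. openin (top_of_set K) V \<and> y \<in> V \<and>
           (\<forall>z w. z \<in> V \<longrightarrow> z \<in> T \<longrightarrow> w \<in> V \<longrightarrow> w \<in> T \<longrightarrow> \<tau> y \<le> \<tau> z \<longrightarrow> \<tau> y \<le> \<tau> w \<longrightarrow>
             \<bar>h z - h w\<bar> < \<epsilon>))"

lemma weak_osc_rankI:
  assumes "\<And>y. y \<in> T \<Longrightarrow> \<exists>V. openin (top_of_set K) V \<and> y \<in> V \<and>
    (\<forall>z w. z \<in> V \<longrightarrow> z \<in> T \<longrightarrow> w \<in> V \<longrightarrow> w \<in> T \<longrightarrow> \<tau> y \<le> \<tau> z \<longrightarrow> \<tau> y \<le> \<tau> w \<longrightarrow> \<bar>h z - h w\<bar> < \<epsilon>)"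
  shows "weak_osc_rank K T h \<epsilon> \<tau>"
  unfolding weak_osc_rank_def by (rule ballI) (rule assms)

lemma weak_osc_rankE:
  assumes "weak_osc_rank K T h \<epsilon> \<tau>" "y \<in> T"
  obtains V where "openin (top_of_set K) V" "y \<in> V"
    "\<And>z w. z \<in> V \<Longrightarrow> z \<in> T \<Longrightarrow> w \<in> V \<Longrightarrow> w \<in> T \<Longrightarrow> \<tau> y \<le> \<tau> z \<Longrightarrow> \<tau> y \<le> \<tau> w \<Longrightarrow> \<bar>h z - h w\<bar> < \<epsilon>"
proof -
  obtain V where V: "openin (top_of_set K) V" "y \<in> V" and
    osc: "\<forall>z w. z \<in> V \<longrightarrow> z \<in> T \<longrightarrow> w \<in> V \<longrightarrow> w \<in> T \<longrightarrow> \<tau> y \<le> \<tau> z \<longrightarrow> \<tau> y \<le> \<tau> w \<longrightarrow> \<bar>h z - h w\<bar> < \<epsilon>"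
    using bspec[OF assms(1)[unfolded weak_osc_rank_def] assms(2)] by (elim exE conjE)
  show thesis by (rule that[OF V]) (rule osc[rule_format])
qed

lemma osc_rank_imp_weak_osc_rank:
  assumes "osc_rank K f \<epsilon> r"
  shows "weak_osc_rank K K f \<epsilon> r"
proof (rule weak_osc_rankI)
  fix x assume "x \<in> K"
  with assms obtain U where U: "openin (top_of_set K) U" "x \<in> U" "\<And>y. y \<in> U \<Longrightarrow> r y \<le> r x"
    "\<And>y z. y \<in> U \<Longrightarrow> z \<in> U \<Longrightarrow> r y = r x \<Longrightarrow> r z = r x \<Longrightarrow> \<bar>f y - f z\<bar> < \<epsilon>"
    by (rule osc_rankE) blast
  show "\<exists>V. openin (top_of_set K) V \<and> x \<in> V \<and>
    (\<forall>z w. z \<in> V \<longrightarrow> z \<in> K \<longrightarrow> w \<in> V \<longrightarrow> w \<in> K \<longrightarrow> r x \<le> r z \<longrightarrow> r x \<le> r w \<longrightarrow> \<bar>f z - f w\<bar> < \<epsilon>)"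
  proof (intro exI[of _ U] conjI allI impI)
    fix z w assume *: "z \<in> U" "w \<in> U" "r x \<le> r z" "r x \<le> r w"
    then have "r z = r x" "r w = r x" using U(3) by (auto intro: order_antisym)
    with U(4) * show "\<bar>f z - f w\<bar> < \<epsilon>" by blast
  qed (use U in auto)
qed

text \<open>As long as the derivation, seen inside the open set \<open>U\<close>, takes place in \<open>T\<close>, each further step
  removes from \<open>U\<close> the points of the smallest remaining rank.\<close>

lemma osc_derived_plus_rank:
  assumes U: "openin (top_of_set K) U" and T: "U \<inter> osc_derived K \<gamma> h \<epsilon> \<subseteq> T"
    and \<tau>: "weak_osc_rank K T h \<epsilon> \<tau>"
  shows "y \<in> U \<Longrightarrow> y \<in> osc_derived K (\<gamma> + \<alpha>) h \<epsilon> \<Longrightarrow> \<alpha> \<le> \<tau> y"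
proof (induction \<alpha> arbitrary: y rule: ordinal_induct)
  case (succ \<alpha>)
  have sub: "U \<inter> osc_derived K (\<gamma> + \<beta>) h \<epsilon> \<subseteq> T" for \<beta>
    using T osc_derived_antimono[OF le_plus_ordinal, of K \<gamma> \<beta> h \<epsilon>] by blast
  have y: "y \<in> osc_step K h \<epsilon> (osc_derived K (\<gamma> + \<alpha>) h \<epsilon>)"
    using succ.prems by (simp add: plus_ordinal_osuc osc_derived_osuc)
  then have y': "y \<in> osc_derived K (\<gamma> + \<alpha>) h \<epsilon>" using osc_step_subset by blast
  have "y \<in> T" using sub y' succ.prems(1) by blast
  have "\<tau> y \<noteq> \<alpha>"
  proof
    assume eq: "\<tau> y = \<alpha>"
    obtain V where V': "openin (top_of_set K) V" "y \<in> V"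
      and osc: "\<And>z w. z \<in> V \<Longrightarrow> z \<in> T \<Longrightarrow> w \<in> V \<Longrightarrow> w \<in> T \<Longrightarrow> \<tau> y \<le> \<tau> z \<Longrightarrow> \<tau> y \<le> \<tau> w \<Longrightarrow> \<bar>h z - h w\<bar> < \<epsilon>"
      using \<tau> \<open>y \<in> T\<close> by (rule weak_osc_rankE) blast
    have "openin (top_of_set K) (U \<inter> V)" "y \<in> U \<inter> V" using U V' succ.prems by auto
    then obtain z w where zw: "z \<in> U \<inter> V \<inter> osc_derived K (\<gamma> + \<alpha>) h \<epsilon>"
      "w \<in> U \<inter> V \<inter> osc_derived K (\<gamma> + \<alpha>) h \<epsilon>" "\<bar>h z - h w\<bar> \<ge> \<epsilon>"
      using y unfolding osc_step_def by blast
    then have "z \<in> T" "w \<in> T" "\<alpha> \<le> \<tau> z" "\<alpha> \<le> \<tau> w" using sub succ.IH by blast+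
    then have "\<bar>h z - h w\<bar> < \<epsilon>" using zw osc unfolding eq by blast
    with zw show False by simp
  qed
  with succ.IH[OF succ.prems(1) y'] show ?case by (metis order_le_less osuc_le_iff)
next
  case (limit \<mu>)
  have "\<alpha> \<le> \<tau> y" if "\<alpha> < \<mu>" for \<alpha>
    using limit that osc_derived_antimono[OF plus_ordinal_mono[OF less_imp_le[OF that]]] by blast
  then show ?case by (simp add: limit_le_iff[OF limit(1)])
qed simp

lemma osc_rank_imp_osc_derived_empty:
  assumes "osc_rank K f \<epsilon> r" and "\<And>x. x \<in> K \<Longrightarrow> r x < \<theta>"
  shows "osc_derived K \<theta> f \<epsilon> = {}"
proof -
  have "\<theta> \<le> r y" if "y \<in> osc_derived K (0 + \<theta>) f \<epsilon>" for y
    using that osc_derived_subset[of K "0 + \<theta>" f \<epsilon>]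
    by (intro osc_derived_plus_rank[of K K 0 f \<epsilon> K r, OF _ _ osc_rank_imp_weak_osc_rank[OF assms(1)]]) (auto simp: osc_derived_0)
  then have "y \<notin> osc_derived K \<theta> f \<epsilon>" for y
    using assms(2) osc_derived_subset[of K \<theta> f \<epsilon>] by (metis not_le subsetD zero_plus_ordinal)
  then show ?thesis by blast
qed

text \<open>By induction, the \<open>\<theta> * \<beta>\<close>-th derived set contains only points with \<open>\<rho> \<ge> \<beta>\<close>. The next \<open>\<theta>\<close> steps
  remove those with \<open>\<rho> = \<beta>\<close>: near such a point \<open>x\<close> the derivation takes place where
  \<open>\<rho> \<ge> \<rho> x\<close>, and the local rank \<open>\<tau>\<close> shows that it is over within \<open>\<theta>\<close> steps. The local rank may depend
  on \<open>x\<close> in any way, since a derived set inside an open set is determined by what happens there.\<close>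

lemma osc_derived_times_rank:
  assumes loc: "\<And>x. x \<in> K \<Longrightarrow> \<exists>U \<tau>. openin (top_of_set K) U \<and> x \<in> U \<and> (\<forall>y\<in>U. \<tau> y < \<theta>) \<and>
      weak_osc_rank K {y\<in>U. \<rho> x \<le> \<rho> y} h \<epsilon> \<tau>"
    and "\<And>x. x \<in> K \<Longrightarrow> \<rho> x < \<gamma>"
  shows "osc_derived K (\<theta> * \<gamma>) h \<epsilon> = {}"
proof -
  have "\<beta> \<le> \<rho> x" if "x \<in> osc_derived K (\<theta> * \<beta>) h \<epsilon>" for x \<beta>
    using that
  proof (induction \<beta> arbitrary: x rule: ordinal_induct)
    case (succ \<beta>)
    have x: "x \<in> osc_derived K (\<theta> * \<beta> + \<theta>) h \<epsilon>" using succ.prems by (simp add: times_ordinal_osuc)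
    then have xK: "x \<in> K" and le: "\<beta> \<le> \<rho> x"
      using osc_derived_subset succ.IH osc_derived_antimono[OF le_plus_ordinal] by blast+
    have "\<rho> x \<noteq> \<beta>"
    proof
      assume eq: "\<rho> x = \<beta>"
      obtain U \<tau> where U: "openin (top_of_set K) U" "x \<in> U"
        and \<tau>: "\<forall>y\<in>U. \<tau> y < \<theta>" "weak_osc_rank K {y\<in>U. \<beta> \<le> \<rho> y} h \<epsilon> \<tau>"
        using loc[OF xK] unfolding eq by (elim exE conjE) (rule that)
      have "\<theta> \<le> \<tau> x"
      proof (rule osc_derived_plus_rank[OF U(1)])
        show "U \<inter> osc_derived K (\<theta> * \<beta>) h \<epsilon> \<subseteq> {y\<in>U. \<beta> \<le> \<rho> y}" using succ.IH by blast
      qed (use U x \<tau> in auto)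
      moreover have "\<tau> x < \<theta>" using \<tau>(1) U(2) by blast
      ultimately show False by simp
    qed
    with le show ?case by (metis order_le_less osuc_le_iff)
  next
    case (limit \<mu>)
    have "\<alpha> \<le> \<rho> x" if "\<alpha> < \<mu>" for \<alpha>
      using limit that osc_derived_antimono[OF times_ordinal_mono[OF less_imp_le[OF that]]] by blast
    then show ?case by (simp add: limit_le_iff[OF limit(1)])
  qed simp
  then show ?thesis
    using assms(2) osc_derived_subset by (metis ex_in_conv not_le subsetD)
qed

section \<open>Sums\<close>

text \<open>Near \<open>x\<close> neither rank exceeds its value at \<open>x\<close>, so points at which the natural sum keeps its value
  have both ranks unchanged.\<close>

lemma osc_rank_add:
  assumes f: "osc_rank K f \<epsilon> r" and g: "osc_rank K g \<delta> s"
  shows "osc_rank K (\<lambda>x. f x + g x) (\<epsilon> + \<delta>) (\<lambda>x. nsum (r x) (s x))"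
  unfolding osc_rank_def
proof
  fix x assume x: "x \<in> K"
  obtain U where U: "openin (top_of_set K) U" "x \<in> U" "\<And>y. y \<in> U \<Longrightarrow> r y \<le> r x"
    "\<And>y z. y \<in> U \<Longrightarrow> z \<in> U \<Longrightarrow> r y = r x \<Longrightarrow> r z = r x \<Longrightarrow> \<bar>f y - f z\<bar> < \<epsilon>"
    using f x by (rule osc_rankE) blast
  obtain V where V: "openin (top_of_set K) V" "x \<in> V" "\<And>y. y \<in> V \<Longrightarrow> s y \<le> s x"
    "\<And>y z. y \<in> V \<Longrightarrow> z \<in> V \<Longrightarrow> s y = s x \<Longrightarrow> s z = s x \<Longrightarrow> \<bar>g y - g z\<bar> < \<delta>"
    using g x by (rule osc_rankE) blast
  let ?\<rho> = "\<lambda>x. nsum (r x) (s x)"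
  have eq: "r y = r x \<and> s y = s x" if "y \<in> U \<inter> V" "?\<rho> y = ?\<rho> x" for y
    using nsum_le_cancel[of "r x" "s x" "r y" "s y"] that U(3)[of y] V(3)[of y] by simp
  have "\<bar>(f y + g y) - (f z + g z)\<bar> < \<epsilon> + \<delta>"
    if "y \<in> U \<inter> V" "z \<in> U \<inter> V" "?\<rho> y = ?\<rho> x" "?\<rho> z = ?\<rho> x" for y z
  proof -
    have "\<bar>f y - f z\<bar> < \<epsilon>" "\<bar>g y - g z\<bar> < \<delta>" using U(4) V(4) eq that by auto
    then show ?thesis by linarith
  qed
  moreover have "openin (top_of_set K) (U \<inter> V)" "x \<in> U \<inter> V" using U V by auto
  moreover have "\<forall>y\<in>U \<inter> V. ?\<rho> y \<le> ?\<rho> x" using U V by (simp add: nsum_mono)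
  ultimately show "\<exists>U. openin (top_of_set K) U \<and> x \<in> U \<and> (\<forall>y\<in>U. ?\<rho> y \<le> ?\<rho> x) \<and>
    (\<forall>y\<in>U. \<forall>z\<in>U. ?\<rho> y = ?\<rho> x \<longrightarrow> ?\<rho> z = ?\<rho> x \<longrightarrow> \<bar>(f y + g y) - (f z + g z)\<bar> < \<epsilon> + \<delta>)"
    by blast
qed

text \<open>For countable \<open>\<theta>\<close> this is the bound \<open>osc_index K f \<le> \<theta>\<close>.\<close>

definition osc_bounded :: "'a::metric_space set \<Rightarrow> ordinal \<Rightarrow> ('a \<Rightarrow> real) \<Rightarrow> bool"
  where "osc_bounded K \<theta> f \<longleftrightarrow> (\<forall>\<epsilon>>0. osc_derived K \<theta> f \<epsilon> = {})"

lemma osc_bounded_iff_rank: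
  "osc_bounded K \<theta> f \<longleftrightarrow> (\<forall>\<epsilon>>0. \<exists>r. (\<forall>x\<in>K. r x < \<theta>) \<and> osc_rank K f \<epsilon> r)"
  unfolding osc_bounded_def using ex_osc_rank osc_rank_imp_osc_derived_empty by metis

lemma osc_boundedE:
  assumes "osc_bounded K \<theta> f" "0 < \<epsilon>"
  obtains r where "\<And>x. x \<in> K \<Longrightarrow> r x < \<theta>" "osc_rank K f \<epsilon> r"
  using assms unfolding osc_bounded_iff_rank by blast

lemma osc_bounded_mono: "osc_bounded K \<theta> f \<Longrightarrow> \<theta> \<le> \<theta>' \<Longrightarrow> osc_bounded K \<theta>' f"
  unfolding osc_bounded_def using osc_derived_antimono[of \<theta> \<theta>' K f] by blast

lemma osc_bounded_add:
  assumes f: "osc_bounded K (omega_pow \<xi>) f" and g: "osc_bounded K (omega_pow \<xi>) g"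
  shows "osc_bounded K (omega_pow \<xi>) (\<lambda>x. f x + g x)"
  unfolding osc_bounded_iff_rank
proof (intro allI impI)
  fix \<epsilon> :: real assume "0 < \<epsilon>"
  then have "0 < \<epsilon> / 2" by simp
  obtain r where r: "\<And>x. x \<in> K \<Longrightarrow> r x < omega_pow \<xi>" "osc_rank K f (\<epsilon> / 2) r"
    using f \<open>0 < \<epsilon> / 2\<close> by (rule osc_boundedE) blast
  obtain s where s: "\<And>x. x \<in> K \<Longrightarrow> s x < omega_pow \<xi>" "osc_rank K g (\<epsilon> / 2) s"
    using g \<open>0 < \<epsilon> / 2\<close> by (rule osc_boundedE) blast
  show "\<exists>r. (\<forall>x\<in>K. r x < omega_pow \<xi>) \<and> osc_rank K (\<lambda>x. f x + g x) \<epsilon> r"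
    using osc_rank_add[OF r(2) s(2)] r(1) s(1) nsum_less_omega_pow
    by (intro exI[of _ "\<lambda>x. nsum (r x) (s x)"]) simp
qed

lemma osc_bounded_uminus: "osc_bounded K \<theta> f \<Longrightarrow> osc_bounded K \<theta> (\<lambda>x. - f x)"
  unfolding osc_bounded_def osc_derived_def osc_step_def by (simp add: abs_minus_commute)

section \<open>Approximation by functions that are continuous on level sets\<close>

text \<open>Countably many balls cover \<open>S\<close> such that \<open>f\<close> is within \<open>\<epsilon>\<close> of a constant on each. A partition of
  unity that belongs to this cover averages the constants; at each point only constants within \<open>\<epsilon>\<close> of
  the value of \<open>f\<close> have positive weight.\<close>

lemma continuous_approximation:
  fixes S :: "'a::metric_space set" and f :: "'a \<Rightarrow> real"
  assumes K: "compact K" and SK: "S \<subseteq> K"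
    and loc: "\<And>x. x \<in> S \<Longrightarrow> \<exists>U. openin (top_of_set S) U \<and> x \<in> U \<and> (\<forall>y\<in>U. \<bar>f y - f x\<bar> \<le> \<epsilon>)"
  shows "\<exists>u. continuous_on S u \<and> (\<forall>x\<in>S. \<bar>f x - u x\<bar> \<le> \<epsilon>)"
proof (cases "S = {}")
  case False
  have "\<exists>k. finite k \<and> K \<subseteq> (\<Union>x\<in>k. ball x (1 / Suc n))" for n :: nat
    using seq_compact_imp_totally_bounded[OF compact_imp_seq_compact[OF K], rule_format, of "1 / Suc n"]
    by auto
  then obtain net where net: "\<And>n::nat. finite (net n)" "\<And>n. K \<subseteq> (\<Union>x\<in>net n. ball x (1 / Suc n))"
    by metis
  define G where "G = {(d, n). d \<in> net n \<and> (\<exists>a. \<forall>y\<in>S \<inter> ball d (1 / Suc n). \<bar>f y - a\<bar> \<le> \<epsilon>)}"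
  have "countable (\<Union>n. net n \<times> {n})" using net(1) by (auto intro: countable_finite)
  then have G_count: "countable G" by (rule countable_subset[rotated]) (auto simp: G_def)
  have cover: "\<exists>(d, n)\<in>G. dist d x < 1 / Suc n" if x: "x \<in> S" for x
  proof -
    obtain U where U: "openin (top_of_set S) U" "x \<in> U" "\<And>y. y \<in> U \<Longrightarrow> \<bar>f y - f x\<bar> \<le> \<epsilon>"
      using loc[OF x] by blast
    obtain e where e: "0 < e" "ball x e \<inter> S \<subseteq> U"
      using U(1,2) by (meson openin_contains_ball)
    obtain n :: nat where n: "1 / Suc n < e / 2" using e(1) nat_approx_posE[of "e / 2"] by auto
    obtain d where d: "d \<in> net n" "dist d x < 1 / Suc n" using net(2)[of n] x SK by auto
    have "y \<in> U" if "y \<in> S \<inter> ball d (1 / Suc n)" for y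
    proof -
      have "dist x y \<le> dist d x + dist d y" using dist_triangle[of x y d] by (simp add: dist_commute)
      also have "\<dots> < e" using that d(2) n by simp
      finally show ?thesis using that e(2) by auto
    qed
    then have "(d, n) \<in> G" using d(1) U(3) unfolding G_def by blast
    with d(2) show ?thesis by blast
  qed
  have "G \<noteq> {}" using False cover by blast
  then obtain c :: "nat \<Rightarrow> _" where c: "range c = G"
    using range_from_nat_into[OF _ G_count] by metis
  define d where "d i = fst (c i)" for i
  define \<delta> where "\<delta> i = 1 / real (Suc (snd (c i)))" for i
  have cG: "c i \<in> G" for i using c by blast
  have "\<forall>i. \<exists>a. \<forall>y\<in>S \<inter> ball (d i) (\<delta> i). \<bar>f y - a\<bar> \<le> \<epsilon>"
    using cG unfolding G_def d_def \<delta>_def by (auto simp: case_prod_beta)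
  then obtain a where a: "\<And>i y. y \<in> S \<Longrightarrow> dist (d i) y < \<delta> i \<Longrightarrow> \<bar>f y - a i\<bar> \<le> \<epsilon>"
    by (metis IntI mem_ball)
  have ex_ball: "\<exists>i. dist (d i) x < \<delta> i" if x: "x \<in> S" for x
  proof -
    obtain p where "p \<in> G" "dist (fst p) x < 1 / Suc (snd p)" using cover[OF x] by auto
    with c show ?thesis unfolding d_def \<delta>_def by (metis rangeE)
  qed
  (* The constants a i may be unbounded: the division by 1 + |a i| makes the series of the weighted
     constants converge uniformly, too. *)
  define w where "w i x = (1/2)^i * (max 0 (\<delta> i - dist (d i) x) / (1 + \<bar>a i\<bar>))" for i x
  have w_nonneg: "0 \<le> w i x" for i x by (simp add: w_def)
  have \<delta>_le: "\<delta> i \<le> 1" for i by (simp add: \<delta>_def)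
  have "max 0 (\<delta> i - dist (d i) x) \<le> 1" for i x
    using \<delta>_le[of i] zero_le_dist[of "d i" x] by linarith
  then have quot: "max 0 (\<delta> i - dist (d i) x) / (1 + \<bar>a i\<bar>) \<le> 1 / (1 + \<bar>a i\<bar>)" for i x
    by (intro divide_right_mono) auto
  have w_le: "w i x \<le> (1/2)^i * (1 / (1 + \<bar>a i\<bar>))" for i x
    unfolding w_def using quot by (intro mult_left_mono) auto
  have w_bound: "norm (w i x) \<le> (1/2)^i" for i x
  proof -
    have "(1/2)^i * (1 / (1 + \<bar>a i\<bar>)) \<le> (1/2)^i * 1"
      by (intro mult_left_mono) auto
    with w_le[of i x] w_nonneg[of i x] show ?thesis by simp
  qed
  have wa_bound: "norm (w i x * a i) \<le> (1/2)^i" for i x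
  proof -
    have "norm (w i x * a i) \<le> ((1/2)^i * (1 / (1 + \<bar>a i\<bar>))) * \<bar>a i\<bar>"
      unfolding real_norm_def abs_mult using w_le[of i x] w_nonneg[of i x] by (intro mult_right_mono) auto
    also have "\<dots> = (1/2)^i * (\<bar>a i\<bar> / (1 + \<bar>a i\<bar>))" by simp
    also have "\<dots> \<le> (1/2)^i * 1" by (intro mult_left_mono) (auto simp: divide_le_eq)
    finally show ?thesis by simp
  qed
  have geo: "summable (\<lambda>i. (1/2)^i :: real)" by (simp add: summable_geometric)
  have cont_w: "continuous_on S (w i)" for i
    unfolding w_def by (intro continuous_intros) auto
  have cont_suminf: "continuous_on S (\<lambda>x. \<Sum>i. g i x)"
    if "\<And>i. continuous_on S (g i)" "\<And>i x. norm (g i x) \<le> (1/2)^i" for g :: "nat \<Rightarrow> 'a \<Rightarrow> real"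
  proof (rule uniform_limit_theorem)
    show "uniform_limit S (\<lambda>n x. \<Sum>i<n. g i x) (\<lambda>x. \<Sum>i. g i x) sequentially"
      using that geo by (intro Weierstrass_m_test) auto
    show "\<forall>\<^sub>F n in sequentially. continuous_on S (\<lambda>x. \<Sum>i<n. g i x)"
      using that by (intro always_eventually allI continuous_on_sum) auto
  qed simp
  define W where "W x = (\<Sum>i. w i x)" for x
  define u where "u x = (\<Sum>i. w i x * a i) / W x" for x
  have sum_w: "summable (\<lambda>i. w i x)" and sum_wa: "summable (\<lambda>i. w i x * a i)" for x
    using w_bound wa_bound by (auto intro: summable_comparison_test'[OF geo])
  have W_pos: "0 < W x" if x: "x \<in> S" for x
  proof -
    obtain i where i: "dist (d i) x < \<delta> i" using ex_ball[OF x] ..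
    have "0 < w i x" unfolding w_def using i by (intro mult_pos_pos divide_pos_pos) auto
    with sum_w w_nonneg show ?thesis unfolding W_def by (intro suminf_pos2) auto
  qed
  have "continuous_on S u"
    unfolding u_def W_def
  proof (intro continuous_on_divide cont_suminf)
    show "\<forall>x\<in>S. (\<Sum>i. w i x) \<noteq> 0" using W_pos unfolding W_def by force
  qed (use cont_w w_bound wa_bound in \<open>auto intro: continuous_on_mult_right\<close>)
  moreover have "\<bar>f x - u x\<bar> \<le> \<epsilon>" if x: "x \<in> S" for x
  proof -
    have term_le: "\<bar>w i x * f x - w i x * a i\<bar> \<le> w i x * \<epsilon>" for i
    proof (cases "dist (d i) x < \<delta> i")
      case True
      then have "w i x * \<bar>f x - a i\<bar> \<le> w i x * \<epsilon>" using a x w_nonneg by (intro mult_left_mono) auto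
      then show ?thesis using w_nonneg[of i x] by (simp add: abs_mult flip: right_diff_distrib)
    qed (simp add: w_def)
    have sum_\<epsilon>: "summable (\<lambda>i. w i x * \<epsilon>)" using sum_w by (rule summable_mult2)
    have sum_abs: "summable (\<lambda>i. \<bar>w i x * f x - w i x * a i\<bar>)"
      by (rule summable_comparison_test'[OF sum_\<epsilon>]) (use term_le in auto)
    have "\<bar>W x * f x - (\<Sum>i. w i x * a i)\<bar> = \<bar>\<Sum>i. w i x * f x - w i x * a i\<bar>"
      unfolding W_def
      by (simp add: suminf_diff[OF summable_mult2[OF sum_w] sum_wa] suminf_mult2[OF sum_w])
    also have "\<dots> \<le> (\<Sum>i. \<bar>w i x * f x - w i x * a i\<bar>)" by (rule summable_rabs[OF sum_abs])
    also have "\<dots> \<le> (\<Sum>i. w i x * \<epsilon>)" by (rule suminf_le[OF term_le sum_abs sum_\<epsilon>])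
    also have "\<dots> = W x * \<epsilon>" unfolding W_def by (simp add: suminf_mult2[OF sum_w])
    finally have "\<bar>W x * f x - W x * u x\<bar> \<le> W x * \<epsilon>" using W_pos[OF x] by (simp add: u_def)
    then show ?thesis using W_pos[OF x] by (simp add: abs_mult flip: right_diff_distrib)
  qed
  ultimately show ?thesis by blast
qed simp

lemma continuous_on_openin_nbhd:
  fixes u :: "'a::metric_space \<Rightarrow> real"
  assumes "continuous_on S u" "x \<in> S" "S \<subseteq> K" "0 < \<delta>"
  obtains V where "openin (top_of_set K) V" "x \<in> V" "\<And>y. y \<in> V \<Longrightarrow> y \<in> S \<Longrightarrow> \<bar>u y - u x\<bar> < \<delta>"
proof -
  have "\<exists>e>0. \<forall>y\<in>S. dist y x < e \<longrightarrow> dist (u y) (u x) < \<delta>"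
    using assms(1,2,4) unfolding continuous_on_iff by blast
  then obtain e where e: "0 < e" "\<And>y. y \<in> S \<Longrightarrow> dist y x < e \<Longrightarrow> \<bar>u y - u x\<bar> < \<delta>"
    unfolding dist_real_def by blast
  show ?thesis
  proof (rule that)
    show "openin (top_of_set K) (K \<inter> ball x e)" by (simp add: openin_open_Int)
    show "x \<in> K \<inter> ball x e" using assms(2,3) e(1) by auto
    show "\<bar>u y - u x\<bar> < \<delta>" if "y \<in> K \<inter> ball x e" "y \<in> S" for y
      using e(2)[of y] that by (simp add: dist_commute)
  qed
qed

lemma osc_rank_of_continuous_on_levels:
  assumes r: "osc_rank K f \<epsilon> r" and u: "\<And>\<alpha>. continuous_on {x\<in>K. r x = \<alpha>} u" and "0 < \<eta>"
  shows "osc_rank K u \<eta> r"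
  unfolding osc_rank_def
proof
  fix x assume x: "x \<in> K"
  obtain U where U: "openin (top_of_set K) U" "x \<in> U" "\<And>y. y \<in> U \<Longrightarrow> r y \<le> r x"
    using r x by (rule osc_rankE) blast
  have "x \<in> {y\<in>K. r y = r x}" "{y\<in>K. r y = r x} \<subseteq> K" "0 < \<eta> / 2" using x \<open>0 < \<eta>\<close> by auto
  with u obtain V where V: "openin (top_of_set K) V" "x \<in> V"
    "\<And>y. y \<in> V \<Longrightarrow> y \<in> {y\<in>K. r y = r x} \<Longrightarrow> \<bar>u y - u x\<bar> < \<eta> / 2"
    by (rule continuous_on_openin_nbhd) blast
  have VK: "V \<subseteq> K" using V(1) by (rule openin_imp_subset)
  have "\<bar>u y - u z\<bar> < \<eta>" if "y \<in> U \<inter> V" "z \<in> U \<inter> V" "r y = r x" "r z = r x" for y z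
  proof -
    have "\<bar>u y - u x\<bar> < \<eta> / 2" "\<bar>u z - u x\<bar> < \<eta> / 2" using V(3) VK that by auto
    then show ?thesis by linarith
  qed
  moreover have "openin (top_of_set K) (U \<inter> V)" "x \<in> U \<inter> V" using U V by auto
  ultimately show "\<exists>U. openin (top_of_set K) U \<and> x \<in> U \<and> (\<forall>y\<in>U. r y \<le> r x) \<and>
    (\<forall>y\<in>U. \<forall>z\<in>U. r y = r x \<longrightarrow> r z = r x \<longrightarrow> \<bar>u y - u z\<bar> < \<eta>)"
    using U(3) by (intro exI[of _ "U \<inter> V"] conjI ballI impI) auto
qed

lemma ex_approximation_continuous_on_levels:
  assumes K: "compact K" and r: "osc_rank K f \<epsilon> r"
  shows "\<exists>u. (\<forall>\<alpha>. continuous_on {x\<in>K. r x = \<alpha>} u) \<and> (\<forall>x\<in>K. \<bar>f x - u x\<bar> \<le> \<epsilon>)"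
proof -
  define S where "S \<alpha> = {x\<in>K. r x = \<alpha>}" for \<alpha>
  have "\<exists>u. continuous_on (S \<alpha>) u \<and> (\<forall>x\<in>S \<alpha>. \<bar>f x - u x\<bar> \<le> \<epsilon>)" for \<alpha>
  proof (rule continuous_approximation[OF K])
    show "S \<alpha> \<subseteq> K" by (auto simp: S_def)
    fix x assume x: "x \<in> S \<alpha>"
    then have "x \<in> K" by (simp add: S_def)
    with r obtain U where U: "openin (top_of_set K) U" "x \<in> U"
      "\<And>y z. y \<in> U \<Longrightarrow> z \<in> U \<Longrightarrow> r y = r x \<Longrightarrow> r z = r x \<Longrightarrow> \<bar>f y - f z\<bar> < \<epsilon>"
      by (rule osc_rankE) blast
    obtain T where "open T" "U = K \<inter> T" using U(1) by (auto simp: openin_open)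
    then have "S \<alpha> \<inter> U = S \<alpha> \<inter> T" using \<open>S \<alpha> \<subseteq> K\<close> by blast
    then have "openin (top_of_set (S \<alpha>)) (S \<alpha> \<inter> U)"
      using \<open>open T\<close> by (simp add: openin_open_Int)
    moreover have "\<bar>f y - f x\<bar> \<le> \<epsilon>" if "y \<in> S \<alpha> \<inter> U" for y
      using U(3)[of y x] that x U(2) by (simp add: S_def)
    ultimately show "\<exists>U. openin (top_of_set (S \<alpha>)) U \<and> x \<in> U \<and> (\<forall>y\<in>U. \<bar>f y - f x\<bar> \<le> \<epsilon>)"
      using x U(2) by (intro exI[of _ "S \<alpha> \<inter> U"] conjI ballI) auto
  qed
  then obtain v where v: "\<And>\<alpha>. continuous_on (S \<alpha>) (v \<alpha>)" "\<And>\<alpha> x. x \<in> S \<alpha> \<Longrightarrow> \<bar>f x - v \<alpha> x\<bar> \<le> \<epsilon>"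
    by metis
  have "continuous_on (S \<alpha>) (\<lambda>x. v (r x) x)" for \<alpha>
    using v(1)[of \<alpha>] by (rule continuous_on_eq) (simp add: S_def)
  then show ?thesis
    using v(2) unfolding S_def by (intro exI[of _ "\<lambda>x. v (r x) x"]) simp
qed

section \<open>Products\<close>

lemma abs_mult_diff_le:
  fixes a b c d :: real
  shows "\<bar>a * b - c * d\<bar> \<le> \<bar>a\<bar> * \<bar>b - d\<bar> + \<bar>d\<bar> * \<bar>a - c\<bar>"
proof -
  have "a * b - c * d = a * (b - d) + d * (a - c)" by (simp add: algebra_simps)
  then show ?thesis using abs_triangle_ineq[of "a * (b - d)" "d * (a - c)"] by (simp add: abs_mult)
qed

text \<open>With \<open>\<bar>g\<bar> \<le> N\<close> on the level set of \<open>\<rho>\<close> near \<open>x\<close>, the two terms of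
  \<open>\<bar>v z\<bar> * \<bar>g z - g w\<bar> + \<bar>g w\<bar> * \<bar>v z - v w\<bar>\<close> are controlled by the rank \<open>\<rho>\<close> of \<open>g\<close> for \<open>\<epsilon> / 2\<close>,
  which is the same for all \<open>x\<close>, and by a rank of \<open>v\<close> for \<open>\<epsilon> / (2 * N)\<close>, which depends on \<open>x\<close> through
  \<open>N\<close> and therefore has to be the inner one.\<close>

lemma osc_bounded_mult_bounded:
  fixes v g :: "'a::metric_space \<Rightarrow> real"
  assumes v: "osc_bounded K \<theta> v" and v_le: "\<And>x. x \<in> K \<Longrightarrow> \<bar>v x\<bar> \<le> 1" and g: "osc_bounded K \<gamma> g"
  shows "osc_bounded K (\<theta> * \<gamma>) (\<lambda>x. v x * g x)"
  unfolding osc_bounded_def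
proof (intro allI impI)
  fix \<epsilon> :: real assume \<epsilon>: "0 < \<epsilon>"
  then have "0 < \<epsilon> / 2" by simp
  obtain \<rho> where \<rho>: "\<And>x. x \<in> K \<Longrightarrow> \<rho> x < \<gamma>" and \<rho>_rank: "osc_rank K g (\<epsilon> / 2) \<rho>"
    using g \<open>0 < \<epsilon> / 2\<close> by (rule osc_boundedE) blast
  show "osc_derived K (\<theta> * \<gamma>) (\<lambda>x. v x * g x) \<epsilon> = {}"
  proof (rule osc_derived_times_rank[where \<rho> = \<rho>, OF _ \<rho>])
    fix x assume x: "x \<in> K"
    obtain U where U: "openin (top_of_set K) U" "x \<in> U" "\<And>y. y \<in> U \<Longrightarrow> \<rho> y \<le> \<rho> x"
      "\<And>y z. y \<in> U \<Longrightarrow> z \<in> U \<Longrightarrow> \<rho> y = \<rho> x \<Longrightarrow> \<rho> z = \<rho> x \<Longrightarrow> \<bar>g y - g z\<bar> < \<epsilon> / 2"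
      using \<rho>_rank x by (rule osc_rankE) blast
    have UK: "U \<subseteq> K" using U(1) by (rule openin_imp_subset)
    define N where "N = \<bar>g x\<bar> + \<epsilon> / 2"
    have N: "0 < N" using \<epsilon> by (simp add: N_def)
    have g_le: "\<bar>g y\<bar> \<le> N" if "y \<in> U" "\<rho> y = \<rho> x" for y
      using U(4)[OF that(1) U(2) that(2) refl] unfolding N_def by linarith
    have "0 < \<epsilon> / (2 * N)" using \<epsilon> N by simp
    with v obtain \<tau> where \<tau>: "\<And>x. x \<in> K \<Longrightarrow> \<tau> x < \<theta>" and \<tau>_rank: "osc_rank K v (\<epsilon> / (2 * N)) \<tau>"
      by (rule osc_boundedE) blast
    have "weak_osc_rank K {y\<in>U. \<rho> x \<le> \<rho> y} (\<lambda>x. v x * g x) \<epsilon> \<tau>"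
    proof (rule weak_osc_rankI)
      fix y assume "y \<in> {y\<in>U. \<rho> x \<le> \<rho> y}"
      then have y: "y \<in> U" "\<rho> x \<le> \<rho> y" by auto
      have "y \<in> K" using UK y by blast
      with \<tau>_rank obtain V where V: "openin (top_of_set K) V" "y \<in> V" "\<And>z. z \<in> V \<Longrightarrow> \<tau> z \<le> \<tau> y"
        "\<And>z w. z \<in> V \<Longrightarrow> w \<in> V \<Longrightarrow> \<tau> z = \<tau> y \<Longrightarrow> \<tau> w = \<tau> y \<Longrightarrow> \<bar>v z - v w\<bar> < \<epsilon> / (2 * N)"
        by (rule osc_rankE) blast
      have "\<bar>v z * g z - v w * g w\<bar> < \<epsilon>"
        if zw: "z \<in> V \<inter> U" "w \<in> V \<inter> U" and le: "\<rho> x \<le> \<rho> z" "\<rho> x \<le> \<rho> w" "\<tau> y \<le> \<tau> z" "\<tau> y \<le> \<tau> w"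
        for z w
      proof -
        have eq: "\<rho> z = \<rho> x" "\<rho> w = \<rho> x" "\<tau> z = \<tau> y" "\<tau> w = \<tau> y"
          using zw le U(3) V(3) by (auto intro: order_antisym)
        have "\<bar>v z\<bar> * \<bar>g z - g w\<bar> \<le> 1 * \<bar>g z - g w\<bar>"
          using v_le[of z] zw UK by (intro mult_right_mono) auto
        also have "\<dots> < \<epsilon> / 2" using U(4)[of z w] zw eq by simp
        finally have 1: "\<bar>v z\<bar> * \<bar>g z - g w\<bar> < \<epsilon> / 2" .
        have "\<bar>g w\<bar> * \<bar>v z - v w\<bar> \<le> N * (\<epsilon> / (2 * N))"
          using g_le[of w] V(4)[of z w] zw eq N by (intro mult_mono) auto
        also have "\<dots> = \<epsilon> / 2" using N by simp
        finally show ?thesis using 1 abs_mult_diff_le[of "v z" "g z" "v w" "g w"] by simp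
      qed
      then show "\<exists>V. openin (top_of_set K) V \<and> y \<in> V \<and> (\<forall>z w. z \<in> V \<longrightarrow> z \<in> {y\<in>U. \<rho> x \<le> \<rho> y} \<longrightarrow>
        w \<in> V \<longrightarrow> w \<in> {y\<in>U. \<rho> x \<le> \<rho> y} \<longrightarrow> \<tau> y \<le> \<tau> z \<longrightarrow> \<tau> y \<le> \<tau> w \<longrightarrow>
          \<bar>v z * g z - v w * g w\<bar> < \<epsilon>)"
        using V(1,2) by (intro exI[of _ V] conjI) auto
    qed
    then show "\<exists>U \<tau>. openin (top_of_set K) U \<and> x \<in> U \<and> (\<forall>y\<in>U. \<tau> y < \<theta>) \<and>
        weak_osc_rank K {y\<in>U. \<rho> x \<le> \<rho> y} (\<lambda>x. v x * g x) \<epsilon> \<tau>"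
      using U(1,2) \<tau> UK by blast
  qed
qed

text \<open>With \<open>\<bar>u\<bar> \<le> M\<close> on the level set of \<open>\<rho>\<close> near \<open>x\<close>, a rank of \<open>g\<close> for \<open>\<epsilon> / (2 * M)\<close> serves as the inner rank.
  On its level sets \<open>g\<close> is bounded by some \<open>N\<close> near each point, and continuity of \<open>u\<close> makes the other
  term small without any further derivation.\<close>

lemma osc_bounded_mult_continuous_on_levels:
  fixes u g :: "'a::metric_space \<Rightarrow> real"
  assumes \<rho>_rank: "osc_rank K f \<delta> \<rho>" and \<rho>: "\<And>x. x \<in> K \<Longrightarrow> \<rho> x < \<gamma>"
    and u: "\<And>\<alpha>. continuous_on {x\<in>K. \<rho> x = \<alpha>} u" and g: "osc_bounded K \<theta> g"
  shows "osc_bounded K (\<theta> * \<gamma>) (\<lambda>x. u x * g x)"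
  unfolding osc_bounded_def
proof (intro allI impI)
  fix \<epsilon> :: real assume \<epsilon>: "0 < \<epsilon>"
  show "osc_derived K (\<theta> * \<gamma>) (\<lambda>x. u x * g x) \<epsilon> = {}"
  proof (rule osc_derived_times_rank[where \<rho> = \<rho>, OF _ \<rho>])
    fix x assume x: "x \<in> K"
    obtain U\<^sub>0 where U\<^sub>0: "openin (top_of_set K) U\<^sub>0" "x \<in> U\<^sub>0" "\<And>y. y \<in> U\<^sub>0 \<Longrightarrow> \<rho> y \<le> \<rho> x"
      using \<rho>_rank x by (rule osc_rankE) blast
    define S where "S = {y\<in>K. \<rho> y = \<rho> x}"
    have S: "continuous_on S u" "x \<in> S" "S \<subseteq> K" using u x by (auto simp: S_def)
    then obtain U\<^sub>1 where U\<^sub>1: "openin (top_of_set K) U\<^sub>1" "x \<in> U\<^sub>1"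
      "\<And>y. y \<in> U\<^sub>1 \<Longrightarrow> y \<in> S \<Longrightarrow> \<bar>u y - u x\<bar> < 1"
      using zero_less_one by (rule continuous_on_openin_nbhd) blast
    define U where "U = U\<^sub>0 \<inter> U\<^sub>1"
    have U: "openin (top_of_set K) U" "x \<in> U" using U\<^sub>0 U\<^sub>1 by (auto simp: U_def)
    have UK: "U \<subseteq> K" using U(1) by (rule openin_imp_subset)
    have US: "y \<in> S" if "y \<in> U" "\<rho> x \<le> \<rho> y" for y
      using that UK U\<^sub>0(3)[of y] by (auto simp: S_def U_def)
    define M where "M = \<bar>u x\<bar> + 1"
    have M: "0 < M" by (simp add: M_def)
    have u_le: "\<bar>u y\<bar> \<le> M" if "y \<in> U" "y \<in> S" for y
    proof -
      have "\<bar>u y - u x\<bar> < 1" using U\<^sub>1(3) that by (simp add: U_def)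
      then show ?thesis unfolding M_def by linarith
    qed
    have \<epsilon>M: "0 < \<epsilon> / (2 * M)" using \<epsilon> M by simp
    with g obtain \<tau> where \<tau>: "\<And>x. x \<in> K \<Longrightarrow> \<tau> x < \<theta>" and \<tau>_rank: "osc_rank K g (\<epsilon> / (2 * M)) \<tau>"
      by (rule osc_boundedE) blast
    have "weak_osc_rank K {y\<in>U. \<rho> x \<le> \<rho> y} (\<lambda>x. u x * g x) \<epsilon> \<tau>"
    proof (rule weak_osc_rankI)
      fix y assume "y \<in> {y\<in>U. \<rho> x \<le> \<rho> y}"
      then have y: "y \<in> U" "\<rho> x \<le> \<rho> y" by auto
      have yK: "y \<in> K" using UK y by blast
      obtain V\<^sub>0 where V\<^sub>0: "openin (top_of_set K) V\<^sub>0" "y \<in> V\<^sub>0" "\<And>z. z \<in> V\<^sub>0 \<Longrightarrow> \<tau> z \<le> \<tau> y"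
        "\<And>z w. z \<in> V\<^sub>0 \<Longrightarrow> w \<in> V\<^sub>0 \<Longrightarrow> \<tau> z = \<tau> y \<Longrightarrow> \<tau> w = \<tau> y \<Longrightarrow> \<bar>g z - g w\<bar> < \<epsilon> / (2 * M)"
        using \<tau>_rank yK by (rule osc_rankE) blast
      define N where "N = \<bar>g y\<bar> + \<epsilon> / (2 * M)"
      have N: "0 < N" using \<epsilon>M by (simp add: N_def)
      have g_le: "\<bar>g z\<bar> \<le> N" if "z \<in> V\<^sub>0" "\<tau> z = \<tau> y" for z
        using V\<^sub>0(4)[OF that(1) V\<^sub>0(2) that(2) refl] unfolding N_def by linarith
      have "0 < \<epsilon> / (4 * N)" using \<epsilon> N by simp
      with S(1) US[OF y] S(3) obtain V\<^sub>1 where V\<^sub>1: "openin (top_of_set K) V\<^sub>1" "y \<in> V\<^sub>1"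
        "\<And>z. z \<in> V\<^sub>1 \<Longrightarrow> z \<in> S \<Longrightarrow> \<bar>u z - u y\<bar> < \<epsilon> / (4 * N)"
        by (rule continuous_on_openin_nbhd) blast
      have "\<bar>u z * g z - u w * g w\<bar> < \<epsilon>"
        if zw: "z \<in> V\<^sub>0 \<inter> V\<^sub>1 \<inter> U" "w \<in> V\<^sub>0 \<inter> V\<^sub>1 \<inter> U"
          and le: "\<rho> x \<le> \<rho> z" "\<rho> x \<le> \<rho> w" "\<tau> y \<le> \<tau> z" "\<tau> y \<le> \<tau> w" for z w
      proof -
        have eq: "z \<in> S" "w \<in> S" "\<tau> z = \<tau> y" "\<tau> w = \<tau> y"
          using zw le US V\<^sub>0(3) by (auto intro: order_antisym)
        have "\<bar>u z\<bar> * \<bar>g z - g w\<bar> \<le> M * \<bar>g z - g w\<bar>"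
          using u_le[of z] zw eq by (intro mult_right_mono) auto
        also have "\<dots> < M * (\<epsilon> / (2 * M))"
          using V\<^sub>0(4)[of z w] zw eq M by (intro mult_strict_left_mono) auto
        also have "\<dots> = \<epsilon> / 2" using M by simp
        finally have 1: "\<bar>u z\<bar> * \<bar>g z - g w\<bar> < \<epsilon> / 2" .
        have "\<bar>u z - u w\<bar> \<le> \<bar>u z - u y\<bar> + \<bar>u w - u y\<bar>" by simp
        also have "\<dots> \<le> \<epsilon> / (4 * N) + \<epsilon> / (4 * N)"
          using V\<^sub>1(3)[of z] V\<^sub>1(3)[of w] zw eq by simp
        also have "\<dots> = \<epsilon> / (2 * N)" by simp
        finally have "\<bar>g w\<bar> * \<bar>u z - u w\<bar> \<le> N * (\<epsilon> / (2 * N))"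
          using g_le[of w] zw eq N by (intro mult_mono) auto
        also have "\<dots> = \<epsilon> / 2" using N by simp
        finally show ?thesis using 1 abs_mult_diff_le[of "u z" "g z" "u w" "g w"] by simp
      qed
      then show "\<exists>V. openin (top_of_set K) V \<and> y \<in> V \<and> (\<forall>z w. z \<in> V \<longrightarrow> z \<in> {y\<in>U. \<rho> x \<le> \<rho> y} \<longrightarrow>
        w \<in> V \<longrightarrow> w \<in> {y\<in>U. \<rho> x \<le> \<rho> y} \<longrightarrow> \<tau> y \<le> \<tau> z \<longrightarrow> \<tau> y \<le> \<tau> w \<longrightarrow>
          \<bar>u z * g z - u w * g w\<bar> < \<epsilon>)"
        using V\<^sub>0(1,2) V\<^sub>1(1,2) by (intro exI[of _ "V\<^sub>0 \<inter> V\<^sub>1"] conjI) auto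
    qed
    then show "\<exists>U \<tau>. openin (top_of_set K) U \<and> x \<in> U \<and> (\<forall>y\<in>U. \<tau> y < \<theta>) \<and>
        weak_osc_rank K {y\<in>U. \<rho> x \<le> \<rho> y} (\<lambda>x. u x * g x) \<epsilon> \<tau>"
      using U(1,2) \<tau> UK by blast
  qed
qed

lemma osc_bounded_mult:
  fixes f g :: "'a::metric_space \<Rightarrow> real"
  assumes K: "compact K" and f: "osc_bounded K (omega_pow \<xi>\<^sub>1) f" and g: "osc_bounded K (omega_pow \<xi>\<^sub>2) g"
  shows "osc_bounded K (omega_pow (max (\<xi>\<^sub>1 + \<xi>\<^sub>2) (\<xi>\<^sub>2 + \<xi>\<^sub>1))) (\<lambda>x. f x * g x)"
proof -
  obtain r where r: "\<And>x. x \<in> K \<Longrightarrow> r x < omega_pow \<xi>\<^sub>1" "osc_rank K f 1 r"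
    using f zero_less_one by (rule osc_boundedE) blast
  obtain u where u: "\<And>\<alpha>. continuous_on {x\<in>K. r x = \<alpha>} u" "\<And>x. x \<in> K \<Longrightarrow> \<bar>f x - u x\<bar> \<le> 1"
    using ex_approximation_continuous_on_levels[OF K r(2)] by blast
  have "osc_bounded K (omega_pow \<xi>\<^sub>1) u"
    using osc_rank_of_continuous_on_levels[OF r(2) u(1)] r(1) unfolding osc_bounded_iff_rank by blast
  then have "osc_bounded K (omega_pow \<xi>\<^sub>1) (\<lambda>x. f x + - u x)"
    using f by (intro osc_bounded_add osc_bounded_uminus)
  then have "osc_bounded K (omega_pow \<xi>\<^sub>1 * omega_pow \<xi>\<^sub>2) (\<lambda>x. (f x + - u x) * g x)"
    using g u(2) by (intro osc_bounded_mult_bounded) auto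
  then have 1: "osc_bounded K (omega_pow (max (\<xi>\<^sub>1 + \<xi>\<^sub>2) (\<xi>\<^sub>2 + \<xi>\<^sub>1))) (\<lambda>x. (f x + - u x) * g x)"
    by (rule osc_bounded_mono) (rule order_trans[OF omega_pow_times_le omega_pow_mono[OF max.cobounded1]])
  have "osc_bounded K (omega_pow \<xi>\<^sub>2 * omega_pow \<xi>\<^sub>1) (\<lambda>x. u x * g x)"
    using r u(1) g by (intro osc_bounded_mult_continuous_on_levels) auto
  then have 2: "osc_bounded K (omega_pow (max (\<xi>\<^sub>1 + \<xi>\<^sub>2) (\<xi>\<^sub>2 + \<xi>\<^sub>1))) (\<lambda>x. u x * g x)"
    by (rule osc_bounded_mono) (rule order_trans[OF omega_pow_times_le omega_pow_mono[OF max.cobounded2]])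
  have "osc_bounded K (omega_pow (max (\<xi>\<^sub>1 + \<xi>\<^sub>2) (\<xi>\<^sub>2 + \<xi>\<^sub>1))) (\<lambda>x. (f x + - u x) * g x + u x * g x)"
    using 1 2 by (rule osc_bounded_add)
  moreover have "(\<lambda>x. (f x + - u x) * g x + u x * g x) = (\<lambda>x. f x * g x)"
    by (simp add: algebra_simps)
  ultimately show ?thesis by simp
qed

lemma Baire1_mult: "f \<in> Baire1 K \<Longrightarrow> g \<in> Baire1 K \<Longrightarrow> (\<lambda>x. f x * g x) \<in> Baire1 K"
proof -
  assume "f \<in> Baire1 K" "g \<in> Baire1 K"
  then obtain F G :: "nat \<Rightarrow> _ \<Rightarrow> real" where
    "\<forall>n. continuous_on K (F n)" "\<forall>x\<in>K. (\<lambda>n. F n x) \<longlonglongrightarrow> f x"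
    "\<forall>n. continuous_on K (G n)" "\<forall>x\<in>K. (\<lambda>n. G n x) \<longlonglongrightarrow> g x"
    unfolding Baire1_def by blast
  then show ?thesis
    unfolding Baire1_def
    by (intro CollectI exI[of _ "\<lambda>n x. F n x * G n x"]) (auto intro: continuous_on_mult tendsto_mult)
qed

theorem theorem6p5:
  fixes K :: "'a::metric_space set"
    and \<xi>\<^sub>1 \<xi>\<^sub>2 :: ordinal
    and f g :: "'a \<Rightarrow> real"
  assumes "compact K"
    and "countable {..<\<xi>\<^sub>1}" and "countable {..<\<xi>\<^sub>2}"
    and "f \<in> Baire1_index K \<xi>\<^sub>1" and "g \<in> Baire1_index K \<xi>\<^sub>2"
  shows "(\<lambda>x. f x * g x) \<in> Baire1_index K (max (\<xi>\<^sub>1 + \<xi>\<^sub>2) (\<xi>\<^sub>2 + \<xi>\<^sub>1))"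
proof -
  have index_iff: "h \<in> Baire1_index K \<xi> \<longleftrightarrow> h \<in> Baire1 K \<and> osc_bounded K (omega_pow \<xi>) h"
    if "countable {..<\<xi>}" for h :: "'a \<Rightarrow> real" and \<xi>
    using osc_index_le_iff[OF countable_omega_pow[OF that]]
    unfolding Baire1_index_def osc_bounded_def by blast
  have "countable {..<max (\<xi>\<^sub>1 + \<xi>\<^sub>2) (\<xi>\<^sub>2 + \<xi>\<^sub>1)}"
    using assms(2,3) by (simp add: max_def countable_plus_ordinal)
  then show ?thesis
    using assms by (simp add: index_iff Baire1_mult osc_bounded_mult)
qed

end
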